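(* Let $G\in\mathcal{R}$, i.e. let $G$ be a robustly monolithic totally disconnected locally compact group. Then every non-discrete dense locally compact subgroup of $G$ also belongs to $\mathcal{R}$. That is, if $H$ is a non-discrete locally compact group admitting a continuous injective homomorphism $\psi\colon H\to G$ with dense image, then $H\in\mathcal{R}$.
   Context: All topological groups are Hausdorff; t.d.l.c. means totally disconnected locally compact. The normal core of a subgroup $L$ of $K$ is $\bigcap_{k\in K}kLk^{-1}$. A t.d.l.c. group $G$ is regionally expansive if some compactly generated open subgroup $O\leq G$ has a compact open subgroup $U$ whose normal core in $O$ is trivial. A locally compact group $G$ is monolithic if the intersection of all its non-trivial closed normal subgroups is non-trivial; this intersection is then the monolith $\mathrm{Mon}(G)$. A t.d.l.c. group $G$ is robustly monolithic if it is monolithic and its monolith is non-discrete, regionally expansive and topologically simple. $\mathcal{R}$ denotes the class of robustly monolithic groups. A dense embedding is a continuous injective homomorphism $\psi\colon H\to G$ between locally compact groups with $\psi(H)$ dense in $G$; a dense locally compact subgroup of $G$ is a locally compact group $H$ that admits a dense embedding into $G$. *)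

theory Defs
  imports "HOL-Analysis.Analysis" "HOL-Algebra.Generated_Groups"
begin

text \<open>Topological groups are Hausdorff throughout. They are given by a group \<open>G\<close> together with an
  abstract topology \<open>T\<close> on its carrier, so that a subgroup \<open>P\<close> is the topological group
  \<open>G\<lparr>carrier := P\<rparr>\<close> with topology \<open>subtopology T P\<close>.\<close>

locale topological_group = group G
  for G :: "('a, 'm) monoid_scheme" (structure) and T :: "'a topology" +
  assumes topspace_eq_carrier: "topspace T = carrier G"
    and continuous_map_mult: "continuous_map (prod_topology T T) T (\<lambda>(x, y). x \<otimes> y)"
    and continuous_map_inv: "continuous_map T T (\<lambda>x. inv x)"
    and Hausdorff: "Hausdorff_space T"

definition locally_compact_group :: "('a, 'm) monoid_scheme \<Rightarrow> 'a topology \<Rightarrow> bool" where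
  "locally_compact_group G T \<longleftrightarrow> topological_group G T \<and> locally_compact_space T"

definition totally_disconnected_space :: "'a topology \<Rightarrow> bool" where
  "totally_disconnected_space T \<longleftrightarrow> (\<forall>x\<in>topspace T. connected_component_of_set T x = {x})"

definition tdlc_group :: "('a, 'm) monoid_scheme \<Rightarrow> 'a topology \<Rightarrow> bool" where
  "tdlc_group G T \<longleftrightarrow> locally_compact_group G T \<and> totally_disconnected_space T"

definition compactly_generated :: "('a, 'm) monoid_scheme \<Rightarrow> 'a topology \<Rightarrow> bool" where
  "compactly_generated G T \<longleftrightarrow> (\<exists>K. compactin T K \<and> generate G K = carrier G)"

definition normal_core :: "('a, 'm) monoid_scheme \<Rightarrow> 'a set \<Rightarrow> 'a set" where
  "normal_core K L = (\<Inter>k\<in>carrier K. k <#\<^bsub>K\<^esub> L #>\<^bsub>K\<^esub> inv\<^bsub>K\<^esub> k)"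

definition regionally_expansive :: "('a, 'm) monoid_scheme \<Rightarrow> 'a topology \<Rightarrow> bool" where
  "regionally_expansive G T \<longleftrightarrow> tdlc_group G T \<and>
     (\<exists>P. subgroup P G \<and> openin T P \<and>
          compactly_generated (G\<lparr>carrier := P\<rparr>) (subtopology T P) \<and>
          (\<exists>U. subgroup U (G\<lparr>carrier := P\<rparr>) \<and>
               compactin (subtopology T P) U \<and> openin (subtopology T P) U \<and>
               normal_core (G\<lparr>carrier := P\<rparr>) U = {\<one>\<^bsub>G\<^esub>}))"

text \<open>Intersecting with the carrier only matters when \<open>G\<close> is trivial: the family of non-trivial
  closed normal subgroups is then empty, and its intersection is \<open>G\<close> rather than \<open>UNIV\<close>.\<close>

definition monolith :: "('a, 'm) monoid_scheme \<Rightarrow> 'a topology \<Rightarrow> 'a set" where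
  "monolith G T = carrier G \<inter> \<Inter>{N. N \<lhd> G \<and> closedin T N \<and> N \<noteq> {\<one>\<^bsub>G\<^esub>}}"

definition monolithic :: "('a, 'm) monoid_scheme \<Rightarrow> 'a topology \<Rightarrow> bool" where
  "monolithic G T \<longleftrightarrow> locally_compact_group G T \<and> monolith G T \<noteq> {\<one>\<^bsub>G\<^esub>}"

definition topologically_simple :: "('a, 'm) monoid_scheme \<Rightarrow> 'a topology \<Rightarrow> bool" where
  "topologically_simple G T \<longleftrightarrow> topological_group G T \<and> carrier G \<noteq> {\<one>\<^bsub>G\<^esub>} \<and>
     (\<forall>N. N \<lhd> G \<and> closedin T N \<longrightarrow> N = {\<one>\<^bsub>G\<^esub>} \<or> N = carrier G)"

definition nondiscrete :: "'a topology \<Rightarrow> bool" where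
  "nondiscrete T \<longleftrightarrow> T \<noteq> discrete_topology (topspace T)"

definition robustly_monolithic :: "('a, 'm) monoid_scheme \<Rightarrow> 'a topology \<Rightarrow> bool" where
  "robustly_monolithic G T \<longleftrightarrow> tdlc_group G T \<and> monolithic G T \<and>
     (let M = G\<lparr>carrier := monolith G T\<rparr>; TM = subtopology T (monolith G T)
      in nondiscrete TM \<and> regionally_expansive M TM \<and> topologically_simple M TM)"

definition dense_embedding ::
  "('b, 'n) monoid_scheme \<Rightarrow> 'b topology \<Rightarrow> ('a, 'm) monoid_scheme \<Rightarrow> 'a topology \<Rightarrow> ('b \<Rightarrow> 'a) \<Rightarrow> bool"
where
  "dense_embedding H S G T \<psi> \<longleftrightarrow> locally_compact_group H S \<and> locally_compact_group G T \<and>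
     \<psi> \<in> hom H G \<and> continuous_map S T \<psi> \<and> inj_on \<psi> (carrier H) \<and>
     T closure_of (\<psi> ` carrier H) = carrier G"

end

theory Submission
  imports Defs "HOL-Algebra.Zassenhaus"
begin

text \<open>
  Let \<open>M\<close> be the monolith of \<open>G\<close>. It cannot be abelian: in an abelian regionally expansive group the
  compact open subgroup with trivial core is itself trivial. Hence the centralizer of \<open>M\<close> in \<open>G\<close> is
  trivial. Monolithicity is used in this form (the locale \<open>robust_monolith\<close>) because a trivial centralizer is
  inherited by every closed subgroup between \<open>M\<close> and \<open>G\<close>, as are the other hypotheses on \<open>(G, M)\<close>.

  The engine is the perturbation lemma \<open>expansive_pair_perturb\<close>. Regional expansivity amounts to having a
  compact open subgroup \<open>U\<close> and a compact set \<open>K\<close> such that no non-trivial element of \<open>U\<close> stays in \<open>U\<close> under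
  all conjugations from \<open>\<langle>K\<rangle>\<close>. Since \<open>K\<close> meets only finitely many cosets of \<open>U\<close>, it may be replaced by a
  finite set \<open>F\<close> picked from any subgroup \<open>D\<close> whose closure is normal and covers \<open>K\<close> up to \<open>U\<close>. Different
  choices of \<open>D\<close> give everything else.

  With \<open>D\<close> the quasi-centre of \<open>M\<close>: if it were non-trivial it would be dense in \<open>M\<close>, and an open subset of
  \<open>U\<close> commuting with \<open>F\<close> would be trivial, so \<open>M\<close> would be discrete. Consequently only \<open>\<one>\<close> in \<open>G\<close> commutes
  with a neighbourhood of \<open>\<one>\<close> in \<open>M\<close>, and this makes \<open>G\<close> regionally expansive, with \<open>K\<close> contained in \<open>MU\<close>.

  With \<open>D\<close> the image of \<open>H\<close>: pulling \<open>F\<close> and \<open>U\<close> back shows that \<open>H\<close> is regionally expansive.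

  With \<open>D\<close> the image of a non-trivial normal subgroup \<open>N\<close> of \<open>H\<close>, whose closure contains \<open>M\<close>: if \<open>N\<close> were
  discrete, \<open>F\<close> would commute with a neighbourhood of \<open>\<one>\<close> in \<open>H\<close>, which would then be trivial. So \<open>N\<close> is
  not discrete.

  Two non-trivial normal subgroups of \<open>H\<close> meet non-trivially, because otherwise their closures, which
  contain \<open>M\<close>, would commute. In a regionally expansive group the non-discrete normal subgroups all meet one
  compact set that omits \<open>\<one>\<close>. By compactness, \<open>H\<close> is monolithic.

  Let \<open>R\<close> be the monolith of \<open>H\<close>. Everything applies again to \<open>R\<close>, as a dense subgroup of the closure of its
  image in \<open>G\<close>. So \<open>R\<close> is regionally expansive and has a monolith of its own, which is normal in \<open>H\<close> and is
  therefore all of \<open>R\<close>; thus \<open>R\<close> is topologically simple.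
\<close>

section \<open>Topological groups\<close>

lemma (in group) inv_mult_cancel [simp]:
  "a \<in> carrier G \<Longrightarrow> x \<in> carrier G \<Longrightarrow> inv a \<otimes> (a \<otimes> x) = x"
  "a \<in> carrier G \<Longrightarrow> x \<in> carrier G \<Longrightarrow> a \<otimes> (inv a \<otimes> x) = x"
  by (simp_all flip: m_assoc)

lemma (in group) commutes_if_commutator_one:
  assumes "x \<in> carrier G" "y \<in> carrier G" "x \<otimes> y \<otimes> inv x \<otimes> inv y = \<one>"
  shows "x \<otimes> y = y \<otimes> x"
proof -
  have "x \<otimes> y = (x \<otimes> y \<otimes> inv x \<otimes> inv y) \<otimes> (y \<otimes> x)"
    using assms(1,2) by (simp add: m_assoc)
  then show ?thesis
    using assms by simp
qed

text \<open>
  The commutator of \<open>a\<close> and \<open>b\<close> lies in both subgroups.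
\<close>

lemma (in group) normals_commute:
  assumes "A \<lhd> G" "B \<lhd> G" "A \<inter> B = {\<one>}" "a \<in> A" "b \<in> B"
  shows "a \<otimes> b = b \<otimes> a"
proof (rule commutes_if_commutator_one)
  interpret A: normal A G by fact
  interpret B: normal B G by fact
  show carr: "a \<in> carrier G" "b \<in> carrier G"
    using assms by auto
  have "a \<otimes> b \<otimes> inv a \<otimes> inv b \<in> B"
    using assms carr by (simp add: B.inv_op_closed2)
  moreover have "a \<otimes> (b \<otimes> inv a \<otimes> inv b) \<in> A"
    using assms carr by (simp add: A.inv_op_closed2)
  ultimately show "a \<otimes> b \<otimes> inv a \<otimes> inv b = \<one>"
    using assms(3) carr by (auto simp: m_assoc)
qed

context topological_group
begin

lemma openin_subset_carrier: "openin T U \<Longrightarrow> U \<subseteq> carrier G"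
  using openin_subset topspace_eq_carrier by blast

lemma continuous_map_group_mult:
  assumes "continuous_map X T f" "continuous_map X T g"
  shows "continuous_map X T (\<lambda>x. f x \<otimes> g x)"
proof -
  have "continuous_map X (prod_topology T T) (\<lambda>x. (f x, g x))"
    using assms by (simp add: continuous_map_pairedI)
  from continuous_map_compose[OF this continuous_map_mult] show ?thesis
    by (simp add: o_def)
qed

lemma continuous_map_group_inv:
  "continuous_map X T f \<Longrightarrow> continuous_map X T (\<lambda>x. inv (f x))"
  using continuous_map_compose[of X T f T "\<lambda>x. inv x"] continuous_map_inv by (simp add: o_def)

lemma continuous_map_group_const: "a \<in> carrier G \<Longrightarrow> continuous_map X T (\<lambda>x. a)"
  using topspace_eq_carrier by simp

lemmas continuous_map_group_intros =
  continuous_map_group_mult continuous_map_group_inv continuous_map_group_const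

lemma openin_preimage_group:
  assumes "continuous_map T T f" "openin T U"
  shows "openin T {x \<in> carrier G. f x \<in> U}"
  using openin_continuous_map_preimage[OF assms] topspace_eq_carrier by simp

lemma openin_l_coset:
  assumes "openin T U" "a \<in> carrier G"
  shows "openin T (a <# U)"
proof -
  have "a <# U = {x \<in> carrier G. inv a \<otimes> x \<in> U}"
    using openin_subset_carrier[OF assms(1)] assms(2)
    by (force simp: l_coset_def)
  moreover have "openin T {x \<in> carrier G. inv a \<otimes> x \<in> U}"
    by (intro openin_preimage_group continuous_map_group_intros continuous_map_id[unfolded id_def] assms)
       (simp add: assms)
  ultimately show ?thesis
    by simp
qed

lemma openin_subgroup_if_nbhd:
  assumes "subgroup L G" "openin T W" "\<one> \<in> W" "W \<subseteq> L"
  shows "openin T L"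
  unfolding openin_subopen[of T L]
proof
  fix x assume x: "x \<in> L"
  interpret L: subgroup L G by fact
  have "openin T (x <# W)"
    using openin_l_coset assms(2) x by simp
  moreover have "x \<in> x <# W"
    using assms(3) x by (force simp: l_coset_def)
  moreover have "x <# W \<subseteq> L"
    using assms(4) x by (auto simp: l_coset_def)
  ultimately show "\<exists>A. openin T A \<and> x \<in> A \<and> A \<subseteq> L"
    by blast
qed

lemma closedin_one: "closedin T {\<one>}"
  using closedin_Hausdorff_sing_eq[OF Hausdorff] topspace_eq_carrier by simp

lemma subset_closure_of_carrier: "A \<subseteq> carrier G \<Longrightarrow> A \<subseteq> T closure_of A"
  by (simp add: closure_of_subset topspace_eq_carrier)

lemma closure_of_subset_carrier: "T closure_of A \<subseteq> carrier G"
  using closure_of_subset_topspace[of T A] topspace_eq_carrier by simp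

text \<open>
  Passing to closures in the factors first and applying continuity of the operation afterwards lets
  subgroups, conjugation and commutation all be treated in the same way.
\<close>

lemma closure_of_binary:
  assumes f: "continuous_map (prod_topology T T) T (\<lambda>(x, y). f x y)"
    and sub: "\<And>x y. x \<in> A \<Longrightarrow> y \<in> B \<Longrightarrow> f x y \<in> C"
    and "x \<in> T closure_of A" "y \<in> T closure_of B"
  shows "f x y \<in> T closure_of C"
proof -
  have "(x, y) \<in> prod_topology T T closure_of (A \<times> B)"
    using assms(3,4) by (simp add: closure_of_Times)
  then have "f x y \<in> T closure_of ((\<lambda>(x, y). f x y) ` (A \<times> B))"
    using continuous_map_image_closure_subset[OF f, of "A \<times> B"] by force
  moreover have "(\<lambda>(x, y). f x y) ` (A \<times> B) \<subseteq> C"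
    using sub by auto
  ultimately show ?thesis
    using closure_of_mono by blast
qed

lemma continuous_map_prod_components:
  "continuous_map (prod_topology T T) T fst" "continuous_map (prod_topology T T) T snd"
  by (simp_all add: continuous_map_fst continuous_map_snd)

lemma closure_of_conj:
  assumes "\<And>d a. d \<in> D \<Longrightarrow> a \<in> A \<Longrightarrow> d \<otimes> a \<otimes> inv d \<in> A"
    and "d \<in> T closure_of D" "a \<in> T closure_of A"
  shows "d \<otimes> a \<otimes> inv d \<in> T closure_of A"
  by (rule closure_of_binary[where f = "\<lambda>x y. x \<otimes> y \<otimes> inv x", OF _ assms])
     (auto simp: case_prod_unfold intro!: continuous_map_group_intros continuous_map_prod_components)

text \<open>
  The commutator map sends \<open>A \<times> B\<close> to \<open>\<one>\<close>, and \<open>{\<one>}\<close> is closed since \<open>T\<close> is Hausdorff.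
\<close>

lemma closure_of_commute:
  assumes "A \<subseteq> carrier G" "B \<subseteq> carrier G"
    and comm: "\<And>a b. a \<in> A \<Longrightarrow> b \<in> B \<Longrightarrow> a \<otimes> b = b \<otimes> a"
    and "a \<in> T closure_of A" "b \<in> T closure_of B"
  shows "a \<otimes> b = b \<otimes> a"
proof (rule commutes_if_commutator_one)
  show carr: "a \<in> carrier G" "b \<in> carrier G"
    using assms closure_of_subset_carrier by blast+
  have "a \<otimes> b \<otimes> inv a \<otimes> inv b \<in> T closure_of {\<one>}"
  proof (rule closure_of_binary[where f = "\<lambda>x y. x \<otimes> y \<otimes> inv x \<otimes> inv y"])
    show "x \<otimes> y \<otimes> inv x \<otimes> inv y \<in> {\<one>}" if "x \<in> A" "y \<in> B" for x y
    proof -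
      have "x \<in> carrier G" "y \<in> carrier G"
        using that assms by auto
      then show ?thesis
        using comm[OF that] by (simp add: m_assoc)
    qed
  qed (use assms in \<open>auto simp: case_prod_unfold
        intro!: continuous_map_group_intros continuous_map_prod_components\<close>)
  then show "a \<otimes> b \<otimes> inv a \<otimes> inv b = \<one>"
    using closedin_one by (simp add: closure_of_closedin)
qed

lemma closure_of_subgroup:
  assumes "subgroup L G"
  shows "subgroup (T closure_of L) G"
proof (rule subgroupI)
  interpret L: subgroup L G by fact
  show "T closure_of L \<subseteq> carrier G"
    by (rule closure_of_subset_carrier)
  show "T closure_of L \<noteq> {}"
    using subset_closure_of_carrier[OF L.subset] L.one_closed by blast
  show "a \<otimes> b \<in> T closure_of L" if "a \<in> T closure_of L" "b \<in> T closure_of L" for a b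
    by (rule closure_of_binary[where f = "\<lambda>x y. x \<otimes> y", OF _ _ that])
       (auto simp: case_prod_unfold intro!: continuous_map_group_intros continuous_map_prod_components)
  show "inv a \<in> T closure_of L" if "a \<in> T closure_of L" for a
    by (rule closure_of_binary[where f = "\<lambda>x y. inv x", OF _ _ that that])
       (auto simp: case_prod_unfold intro!: continuous_map_group_intros continuous_map_prod_components)
qed

lemma closure_of_normal_in_closure:
  assumes "subgroup D G" "subgroup N G"
    and "\<And>d n. d \<in> D \<Longrightarrow> n \<in> N \<Longrightarrow> d \<otimes> n \<otimes> inv d \<in> N"
    and dense: "T closure_of D = carrier G"
  shows "T closure_of N \<lhd> G"
  using closure_of_subgroup[OF assms(2)] closure_of_conj[OF assms(3)] dense
  by (auto simp: normal_inv_iff)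

lemma closure_of_subset_mult_open:
  assumes D: "subgroup D G" and U: "subgroup U G" "openin T U"
  shows "T closure_of D \<subseteq> D <#> U"
proof
  fix x assume x: "x \<in> T closure_of D"
  interpret D: subgroup D G by fact
  interpret U: subgroup U G by fact
  have xG: "x \<in> carrier G"
    using x closure_of_subset_carrier by blast
  have "x \<in> x <# U"
    using xG by (force simp: l_coset_def)
  then obtain d where d: "d \<in> D" "d \<in> x <# U"
    using x openin_l_coset[OF U(2) xG] unfolding in_closure_of by blast
  then obtain u where u: "u \<in> U" "d = x \<otimes> u"
    by (auto simp: l_coset_def)
  then have "x = d \<otimes> inv u"
    using xG by (simp add: m_assoc)
  then show "x \<in> D <#> U"
    using d u unfolding set_mult_def by auto
qed

lemma subgroup_topological_group:
  assumes "subgroup L G"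
  shows "topological_group (G\<lparr>carrier := L\<rparr>) (subtopology T L)"
proof -
  interpret L: subgroup L G by fact
  interpret GL: group "G\<lparr>carrier := L\<rparr>"
    using assms by (rule subgroup_imp_group)
  have ts: "topspace (subtopology T L) = L"
    using topspace_eq_carrier L.subset by auto
  show ?thesis
  proof (intro topological_group.intro topological_group_axioms.intro)
    show "group (G\<lparr>carrier := L\<rparr>)"
      by (rule GL.group_axioms)
    show "topspace (subtopology T L) = carrier (G\<lparr>carrier := L\<rparr>)"
      using ts by simp
    show "Hausdorff_space (subtopology T L)"
      by (rule Hausdorff_space_subtopology[OF Hausdorff])
    have "continuous_map (subtopology T L) T (\<lambda>x. inv x)"
      by (rule continuous_map_from_subtopology[OF continuous_map_inv])
    then have "continuous_map (subtopology T L) (subtopology T L) (\<lambda>x. inv x)"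
      by (rule continuous_map_into_subtopology) (use ts in auto)
    then show "continuous_map (subtopology T L) (subtopology T L)
        (\<lambda>x. inv\<^bsub>G\<lparr>carrier := L\<rparr>\<^esub> x)"
      by (rule continuous_map_eq) (use assms ts in simp)
    have "continuous_map (prod_topology (subtopology T L) (subtopology T L)) T (\<lambda>(x, y). x \<otimes> y)"
      using continuous_map_from_subtopology[OF continuous_map_mult, of "L \<times> L"]
      by (simp add: subtopology_Times)
    then show "continuous_map (prod_topology (subtopology T L) (subtopology T L)) (subtopology T L)
        (\<lambda>(x, y). x \<otimes>\<^bsub>G\<lparr>carrier := L\<rparr>\<^esub> y)"
      by (simp add: continuous_map_in_subtopology ts Pi_iff)
  qed
qed

end

lemma discrete_if_open_singleton_one:
  fixes G (structure)
  assumes "topological_group G T" "openin T {\<one>}"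
  shows "\<not> nondiscrete T"
proof -
  interpret topological_group G T by fact
  have "openin T {x}" if "x \<in> topspace T" for x
  proof -
    have "x \<in> carrier G"
      using that topspace_eq_carrier by simp
    then show ?thesis
      using openin_l_coset[OF assms(2), of x] by (simp add: l_coset_def)
  qed
  then show ?thesis
    unfolding nondiscrete_def by (metis discrete_topology_unique)
qed

lemma totally_disconnected_if_injective_map:
  assumes f: "continuous_map S T f" "inj_on f (topspace S)" and T: "totally_disconnected_space T"
  shows "totally_disconnected_space S"
  unfolding totally_disconnected_space_def
proof (intro ballI equalityI subsetI)
  fix x y assume x: "x \<in> topspace S" and y: "y \<in> connected_component_of_set S x"
  then obtain C where C: "connectedin S C" "x \<in> C" "y \<in> C"
    by (auto simp: connected_component_of_def)
  have "connectedin T (f ` C)"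
    using f(1) C(1) by (rule connectedin_continuous_map_image)
  then have "f y \<in> connected_component_of_set T (f x)"
    using C unfolding connected_component_of_def by blast
  moreover have "f x \<in> topspace T"
    using f(1) x by (auto simp: continuous_map_def)
  ultimately have "f y = f x"
    using T unfolding totally_disconnected_space_def by blast
  moreover have "y \<in> topspace S"
    using C connectedin_subset_topspace by blast
  ultimately show "y \<in> {x}"
    using f(2) x by (auto dest: inj_onD)
next
  fix x y assume "x \<in> topspace S" "y \<in> {x}"
  then show "y \<in> connected_component_of_set S x"
    by (simp add: connected_component_of_refl)
qed

lemma tdlc_group_closed_subgroup:
  assumes G: "tdlc_group G T" and L: "subgroup L G" "closedin T L"
  shows "tdlc_group (G\<lparr>carrier := L\<rparr>) (subtopology T L)"
proof -
  interpret topological_group G T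
    using G by (simp add: tdlc_group_def locally_compact_group_def)
  have "totally_disconnected_space (subtopology T L)"
    by (rule totally_disconnected_if_injective_map[of _ T "\<lambda>x. x"])
       (use G in \<open>simp_all add: tdlc_group_def continuous_map_from_subtopology\<close>)
  then show ?thesis
    using G subgroup_topological_group[OF L(1)] locally_compact_space_closed_subset[OF _ L(2)]
    by (simp add: tdlc_group_def locally_compact_group_def)
qed

subsection \<open>Compact open subgroups\<close>

text \<open>
  In a locally compact Hausdorff space a compact connected component can be separated by a clopen set
  from any disjoint closed set. Here the component is \<open>{x}\<close>, and the closed set is the
  complement of a neighbourhood inside a compact set.
\<close>

lemma compact_open_nbhd:
  assumes "locally_compact_space X" "Hausdorff_space X" "totally_disconnected_space X"
    and "openin X A" "x \<in> A"
  obtains C where "compactin X C" "openin X C" "x \<in> C" "C \<subseteq> A"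
proof -
  have x: "x \<in> topspace X"
    using assms openin_subset by blast
  then obtain U K where UK: "openin X U" "compactin X K" "x \<in> U" "U \<subseteq> K"
    using assms(1) unfolding locally_compact_space_def by blast
  have comp: "connected_component_of_set X x = {x}"
    using assms(3) x by (simp add: totally_disconnected_space_def)
  have "separated_between X {x} (topspace X - (A \<inter> U))"
  proof (rule separated_between_compact_connected_component[OF assms(1,2)])
    show "{x} \<in> connected_components_of X"
      using comp x unfolding connected_components_of_def by blast
    show "compactin X {x}"
      using x by simp
    show "closedin X (topspace X - (A \<inter> U))"
      using assms(4) UK(1) by (intro closedin_diff closedin_topspace openin_Int)
    show "disjnt {x} (topspace X - (A \<inter> U))"
      using assms(5) UK(3) by simp
  qed
  then obtain C where C: "closedin X C" "openin X C" "{x} \<subseteq> C"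
      "topspace X - (A \<inter> U) \<subseteq> topspace X - C"
    unfolding separated_between by blast
  then have "C \<subseteq> A \<inter> U"
    using openin_subset by fastforce
  moreover from this have "compactin X C"
    using closed_compactin[OF UK(2) _ C(1)] UK(4) by blast
  ultimately show thesis
    using that C by blast
qed

text \<open>
  A compact open neighbourhood \<open>C\<close> of \<open>\<one>\<close> need not be a subgroup, but its stabilizer under right
  translation is one. It is contained in \<open>C\<close> because \<open>\<one> \<in> C\<close>, and it is open by the tube lemma because \<open>C\<close> is
  compact.
\<close>

theorem van_Dantzig:
  fixes G (structure)
  assumes G: "tdlc_group G T" and A: "openin T A" "\<one> \<in> A"
  obtains U where "subgroup U G" "compactin T U" "openin T U" "U \<subseteq> A"
proof -
  interpret topological_group G T
    using G by (simp add: tdlc_group_def locally_compact_group_def)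
  obtain C where C: "compactin T C" "openin T C" "\<one> \<in> C" "C \<subseteq> A"
    using compact_open_nbhd[OF _ Hausdorff _ A] G
    by (auto simp: tdlc_group_def locally_compact_group_def)
  have CG: "C \<subseteq> carrier G"
    using C(2) openin_subset_carrier by blast
  define U where "U = {g \<in> carrier G. \<forall>c\<in>C. c \<otimes> g \<in> C \<and> c \<otimes> inv g \<in> C}"
  have U: "subgroup U G"
  proof (rule subgroupI)
    show "U \<subseteq> carrier G"
      by (auto simp: U_def)
    have "\<one> \<in> U"
      using C CG by (auto simp: U_def)
    then show "U \<noteq> {}"
      by blast
    show "inv a \<in> U" if "a \<in> U" for a
      using that by (auto simp: U_def)
    show "a \<otimes> b \<in> U" if "a \<in> U" "b \<in> U" for a b
    proof -
      have "c \<otimes> (a \<otimes> b) = c \<otimes> a \<otimes> b" "c \<otimes> inv (a \<otimes> b) = c \<otimes> inv b \<otimes> inv a" if "c \<in> C" for c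
        using \<open>a \<in> U\<close> \<open>b \<in> U\<close> that CG by (auto simp: U_def inv_mult_group m_assoc)
      then show ?thesis
        using that by (auto simp: U_def)
    qed
  qed
  \<comment> \<open>An open set containing \<open>C \<times> {\<one>}\<close>, hence a tube \<open>C \<times> W\<close> around it.\<close>
  define P where "P = {z \<in> topspace (prod_topology T T). fst z \<otimes> snd z \<in> C \<and> fst z \<otimes> inv (snd z) \<in> C}"
  have "P = {z \<in> topspace (prod_topology T T). fst z \<otimes> snd z \<in> C} \<inter>
            {z \<in> topspace (prod_topology T T). fst z \<otimes> inv (snd z) \<in> C}"
    by (auto simp: P_def)
  also have "openin (prod_topology T T) \<dots>"
    by (intro openin_Int openin_continuous_map_preimage[OF _ C(2)]
        continuous_map_group_intros continuous_map_prod_components)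
  finally have P: "openin (prod_topology T T) P" .
  have "C \<times> {\<one>} \<subseteq> P"
    using CG by (auto simp: P_def topspace_eq_carrier)
  then obtain B W where "openin T W" "\<one> \<in> W" "C \<subseteq> B" "B \<times> W \<subseteq> P"
    using tube_lemma_left[OF P C(1), of \<one>] topspace_eq_carrier by auto
  then have W: "openin T W" "\<one> \<in> W" "C \<times> W \<subseteq> P"
    by auto
  have "W \<subseteq> U"
    using W(3) openin_subset_carrier[OF W(1)] by (auto simp: U_def P_def)
  then have "openin T U"
    using openin_subgroup_if_nbhd[OF U W(1,2)] by simp
  have "U \<subseteq> C"
    using C(3) by (force simp: U_def)
  \<comment> \<open>Open subgroups are closed, and a closed subset of \<open>C\<close> is compact.\<close>
  have "closedin T U"
  proof -
    have "T closure_of U \<subseteq> U <#> U"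
      using closure_of_subset_mult_open[OF U U \<open>openin T U\<close>] .
    also have "\<dots> \<subseteq> U"
      using subgroup.m_closed[OF U] by (auto simp: set_mult_def)
    finally show ?thesis
      using subgroup.subset[OF U] by (metis closure_of_subset_eq topspace_eq_carrier)
  qed
  then have "compactin T U"
    using closed_compactin[OF C(1) \<open>U \<subseteq> C\<close>] by simp
  then show thesis
    using that U \<open>openin T U\<close> \<open>U \<subseteq> C\<close> C(4) by blast
qed

section \<open>Regional expansivity\<close>

text \<open>
  When \<open>D\<close> is a subgroup this is the intersection of the conjugates \<open>d U d\<^sup>-\<^sup>1\<close>, so for \<open>U \<subseteq> D\<close> it is the normal
  core of \<open>U\<close> in \<open>D\<close>. Stating it elementwise allows subgroups \<open>D\<close> that do not contain \<open>U\<close>, in particular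
  finitely generated ones.
\<close>

definition conj_core :: "('a, 'm) monoid_scheme \<Rightarrow> 'a set \<Rightarrow> 'a set \<Rightarrow> 'a set" where
  "conj_core G D U = {x \<in> carrier G. \<forall>d\<in>D. inv\<^bsub>G\<^esub> d \<otimes>\<^bsub>G\<^esub> x \<otimes>\<^bsub>G\<^esub> d \<in> U}"

text \<open>
  A witness of regional expansivity that stays inside \<open>G\<close>: the open subgroup is the one generated by
  \<open>K\<close> and \<open>U\<close>, and it is never named.
\<close>

definition expansive_pair ::
  "('a, 'm) monoid_scheme \<Rightarrow> 'a topology \<Rightarrow> 'a set \<Rightarrow> 'a set \<Rightarrow> bool" where
  "expansive_pair G T K U \<longleftrightarrow> compactin T K \<and> subgroup U G \<and> compactin T U \<and> openin T U \<and>
     conj_core G (generate G K) U = {\<one>\<^bsub>G\<^esub>}"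

lemma (in group) mem_set_mult_right:
  assumes "\<one> \<in> A" "b \<in> B" "b \<in> carrier G"
  shows "b \<in> A <#> B"
proof -
  have "b = \<one> \<otimes> b"
    using assms by simp
  then show ?thesis
    unfolding set_mult_def using assms by blast
qed

lemma (in group) one_mem_conj_core: "D \<subseteq> carrier G \<Longrightarrow> subgroup U G \<Longrightarrow> \<one> \<in> conj_core G D U"
  by (auto simp: conj_core_def subgroup.one_closed)

lemma (in group) normal_core_eq_conj_core:
  assumes P: "subgroup P G" and U: "subgroup U G" "U \<subseteq> P"
  shows "normal_core (G\<lparr>carrier := P\<rparr>) U = conj_core G P U"
proof -
  interpret P: subgroup P G by fact
  interpret U: subgroup U G by fact
  have mem: "x \<in> k <# U #> inv k \<longleftrightarrow> x \<in> carrier G \<and> inv k \<otimes> x \<otimes> k \<in> U" if "k \<in> P" for k x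
  proof
    assume "x \<in> k <# U #> inv k"
    then obtain u where "u \<in> U" "x = k \<otimes> u \<otimes> inv k"
      by (auto simp: l_coset_def r_coset_def)
    then show "x \<in> carrier G \<and> inv k \<otimes> x \<otimes> k \<in> U"
      using that by (simp add: m_assoc)
  next
    assume x: "x \<in> carrier G \<and> inv k \<otimes> x \<otimes> k \<in> U"
    then have "x = k \<otimes> (inv k \<otimes> x \<otimes> k) \<otimes> inv k"
      using that by (simp add: m_assoc)
    then show "x \<in> k <# U #> inv k"
      using x unfolding l_coset_def r_coset_def by blast
  qed
  have "normal_core (G\<lparr>carrier := P\<rparr>) U = (\<Inter>k\<in>P. k <# U #> inv k)"
    using P by (simp add: normal_core_def l_coset_def r_coset_def)
  also have "\<dots> = conj_core G P U"
    unfolding conj_core_def using mem P.one_closed by blast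
  finally show ?thesis .
qed

context topological_group
begin

lemma compactin_carrier: "compactin T K \<Longrightarrow> K \<subseteq> carrier G"
  using compactin_subset_topspace topspace_eq_carrier by metis

lemma compactin_mult:
  assumes "compactin T A" "compactin T B"
  shows "compactin T (A <#> B)"
proof -
  have "compactin T ((\<lambda>(x, y). x \<otimes> y) ` (A \<times> B))"
    using image_compactin[OF _ continuous_map_mult] assms by (simp add: compactin_Times)
  moreover have "(\<lambda>(x, y). x \<otimes> y) ` (A \<times> B) = A <#> B"
    by (auto simp: set_mult_def)
  ultimately show ?thesis
    by simp
qed

lemma regionally_expansive_imp_expansive_pair:
  assumes "regionally_expansive G T"
  obtains K U where "expansive_pair G T K U"
proof -
  obtain P U where P: "subgroup P G" "openin T P"
    and gen: "compactly_generated (G\<lparr>carrier := P\<rparr>) (subtopology T P)"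
    and U: "subgroup U (G\<lparr>carrier := P\<rparr>)" "compactin (subtopology T P) U"
      "openin (subtopology T P) U" "normal_core (G\<lparr>carrier := P\<rparr>) U = {\<one>}"
    using assms unfolding regionally_expansive_def by auto
  obtain K where K: "compactin (subtopology T P) K" "generate (G\<lparr>carrier := P\<rparr>) K = P"
    using gen by (auto simp: compactly_generated_def)
  have KP: "K \<subseteq> P" "compactin T K"
    using K(1) by (auto simp: compactin_subtopology)
  have UP: "U \<subseteq> P" "compactin T U" "subgroup U G" "openin T U"
    using U(2,3) P(2) incl_subgroup[OF P(1) U(1)]
    by (auto simp: compactin_subtopology openin_open_subtopology)
  have "conj_core G (generate G K) U = {\<one>}"
    using K(2) KP(1) P(1) U(4) UP by (simp add: generate_consistent normal_core_eq_conj_core)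
  then show thesis
    using that KP UP by (simp add: expansive_pair_def)
qed

lemma expansive_pair_imp_regionally_expansive:
  assumes "tdlc_group G T" "expansive_pair G T K U"
  shows "regionally_expansive G T"
proof -
  have K: "compactin T K" and U: "subgroup U G" "compactin T U" "openin T U"
    and core: "conj_core G (generate G K) U = {\<one>}"
    using assms(2) by (auto simp: expansive_pair_def)
  define P where "P = generate G (K \<union> U)"
  have KU: "K \<union> U \<subseteq> carrier G" "compactin T (K \<union> U)"
    using K U compactin_carrier by (auto intro: compactin_Un)
  have P: "subgroup P G"
    unfolding P_def using KU(1) by (rule generate_is_subgroup)
  have sub: "K \<union> U \<subseteq> P"
    unfolding P_def by (auto intro: generate.incl)
  have "openin T P"
    using openin_subgroup_if_nbhd[OF P U(3)] sub subgroup.one_closed[OF U(1)] by blast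
  have "compactly_generated (G\<lparr>carrier := P\<rparr>) (subtopology T P)"
    unfolding compactly_generated_def
    by (rule exI[of _ "K \<union> U"])
      (use KU sub P in \<open>auto simp: compactin_subtopology generate_consistent P_def\<close>)
  moreover have "normal_core (G\<lparr>carrier := P\<rparr>) U = {\<one>}"
  proof -
    have "generate G K \<subseteq> P"
      unfolding P_def by (rule mono_generate) simp
    then have "conj_core G P U \<subseteq> {\<one>}"
      using core by (auto simp: conj_core_def)
    then show ?thesis
      using one_mem_conj_core[OF subgroup.subset[OF P] U(1)] sub
        normal_core_eq_conj_core[OF P U(1)] by auto
  qed
  moreover have "subgroup U (G\<lparr>carrier := P\<rparr>)" "compactin (subtopology T P) U"
      "openin (subtopology T P) U"
    using subgroup_incl[OF U(1) P] U sub \<open>openin T P\<close>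
    by (simp_all add: compactin_subtopology openin_open_subtopology)
  ultimately show ?thesis
    unfolding regionally_expansive_def using assms(1) P \<open>openin T P\<close> by blast
qed

text \<open>
  Perturbing a single generator \<open>k\<close> to an element of \<open>D\<close> in \<open>k U\<close> changes the group it generates, and hence its
  core. The set \<open>UK \<union> UK\<^sup>-\<^sup>1\<close> is compact and contained in \<open>DU\<close>, so it is covered by \<open>FU\<close> for some finite
  \<open>F \<subseteq> D\<close>. Then \<open>\<langle>F\<rangle>U\<close> is stable under right multiplication by \<open>K\<close> and \<open>K\<^sup>-\<^sup>1\<close>, so it contains \<open>\<langle>K\<rangle>\<close>. Conjugating
  by the factor in \<open>U\<close> does not leave \<open>U\<close>; therefore elements that \<open>\<langle>F\<rangle>\<close> keeps in \<open>U\<close> are kept in \<open>U\<close> by \<open>\<langle>K\<rangle>\<close>.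
\<close>

lemma expansive_pair_perturb:
  assumes pair: "expansive_pair G T K U"
    and D: "subgroup D G" "T closure_of D \<lhd> G" "K \<subseteq> T closure_of D <#> U"
  obtains F where "finite F" "F \<subseteq> D" "expansive_pair G T F U"
proof -
  have K: "compactin T K" and U: "subgroup U G" "compactin T U" "openin T U"
    and core: "conj_core G (generate G K) U = {\<one>}"
    using pair by (auto simp: expansive_pair_def)
  interpret D: subgroup D G by fact
  interpret U: subgroup U G by fact
  interpret N: normal "T closure_of D" G by fact
  define NU where "NU = T closure_of D <#> U"
  have NU: "subgroup NU G"
    unfolding NU_def by (rule mult_norm_subgroup[OF D(2) U(1)])
  have "u \<in> NU" if "u \<in> U" for u
    unfolding NU_def using mem_set_mult_right that N.one_closed U.mem_carrier by blast
  moreover have "inv k \<in> NU" if "k \<in> K" for k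
    using subgroup.m_inv_closed[OF NU] that D(3) by (auto simp: NU_def)
  moreover have "k \<in> NU" if "k \<in> K" for k
    using that D(3) by (auto simp: NU_def)
  moreover define Z where "Z = U <#> (K \<union> (\<lambda>x. inv x) ` K)"
  ultimately have "Z \<subseteq> NU"
    using subgroup.m_closed[OF NU] by (auto simp: set_mult_def)
  also have "NU \<subseteq> (D <#> U) <#> U"
    unfolding NU_def using mono_set_mult[OF closure_of_subset_mult_open[OF D(1) U(1,3)] subset_refl] .
  also have "\<dots> \<subseteq> D <#> U"
  proof
    fix x assume "x \<in> (D <#> U) <#> U"
    then obtain d u v where "d \<in> D" "u \<in> U" "v \<in> U" "x = d \<otimes> (u \<otimes> v)"
      by (auto simp: set_mult_def m_assoc)
    then show "x \<in> D <#> U"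
      unfolding set_mult_def using U.m_closed by blast
  qed
  finally have "Z \<subseteq> \<Union> ((\<lambda>d. d <# U) ` D)"
    by (auto simp: set_mult_def l_coset_def)
  moreover have "compactin T Z"
    unfolding Z_def using K U(2) image_compactin[OF K continuous_map_inv]
    by (intro compactin_mult compactin_Un)
  moreover have "openin T (d <# U)" if "d \<in> D" for d
    using that openin_l_coset U(3) by simp
  ultimately obtain \<F> where "finite \<F>" "\<F> \<subseteq> (\<lambda>d. d <# U) ` D" "Z \<subseteq> \<Union>\<F>"
    using compactinD[of T Z "(\<lambda>d. d <# U) ` D"] by blast
  then obtain F where F: "finite F" "F \<subseteq> D" "Z \<subseteq> (\<Union>d\<in>F. d <# U)"
    by (metis finite_subset_image)
  have FG: "F \<subseteq> carrier G"
    using F(2) D.subset by blast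
  interpret F: subgroup "generate G F" G
    using FG by (rule generate_is_subgroup)
  define Y where "Y = generate G F <#> U"
  \<comment> \<open>For \<open>y = f u\<close>, the product \<open>u k\<close> lies in \<open>FU\<close>, and the new left factor is absorbed by \<open>\<langle>F\<rangle>\<close>.\<close>
  have YK: "y \<otimes> k \<in> Y" if y: "y \<in> Y" and k: "k \<in> K \<union> (\<lambda>x. inv x) ` K" for y k
  proof -
    obtain f u where fu: "f \<in> generate G F" "u \<in> U" "y = f \<otimes> u"
      using y by (auto simp: Y_def set_mult_def)
    have kG: "k \<in> carrier G"
      using k compactin_carrier[OF K] by auto
    have "u \<otimes> k \<in> Z"
      using fu k by (auto simp: Z_def set_mult_def)
    then obtain d v where dv: "d \<in> F" "v \<in> U" "u \<otimes> k = d \<otimes> v"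
      using F(3) by (auto simp: l_coset_def)
    have "y \<otimes> k = (f \<otimes> d) \<otimes> v"
      using fu dv kG FG by (simp add: m_assoc subset_iff)
    moreover have "f \<otimes> d \<in> generate G F"
      using fu dv by (blast intro: generate.eng generate.incl)
    ultimately show ?thesis
      using dv unfolding Y_def set_mult_def by blast
  qed
  have YG: "Y \<subseteq> carrier G"
    by (auto simp: Y_def set_mult_def)
  have "y \<otimes> p \<in> Y" if "p \<in> generate G K" "y \<in> Y" for y p
    using that
  proof (induction p arbitrary: y)
    case (eng h1 h2)
    then have "y \<otimes> (h1 \<otimes> h2) = y \<otimes> h1 \<otimes> h2"
      using YG generate_in_carrier[OF compactin_carrier[OF K]] by (simp add: m_assoc subset_iff)
    then show ?case
      using eng by simp
  qed (use YK YG in auto)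
  moreover have "\<one> \<in> Y"
    unfolding Y_def using mem_set_mult_right F.one_closed U.one_closed by blast
  ultimately have PY: "p \<in> Y" if "p \<in> generate G K" for p
    using that generate_in_carrier[OF compactin_carrier[OF K]] by fastforce
  have "conj_core G (generate G F) U \<subseteq> conj_core G (generate G K) U"
  proof
    fix x assume x: "x \<in> conj_core G (generate G F) U"
    then have xG: "x \<in> carrier G"
      by (simp add: conj_core_def)
    have "inv p \<otimes> x \<otimes> p \<in> U" if p: "p \<in> generate G K" for p
    proof -
      obtain f u where fu: "f \<in> generate G F" "u \<in> U" "p = f \<otimes> u"
        using PY[OF p] by (auto simp: Y_def set_mult_def)
      then have "inv f \<otimes> x \<otimes> f \<in> U"
        using x by (auto simp: conj_core_def)
      then have "inv u \<otimes> (inv f \<otimes> x \<otimes> f) \<otimes> u \<in> U"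
        using fu by simp
      then show ?thesis
        using fu xG by (simp add: m_assoc inv_mult_group)
    qed
    then show "x \<in> conj_core G (generate G K) U"
      using xG by (simp add: conj_core_def)
  qed
  then have "conj_core G (generate G F) U = {\<one>}"
    using core one_mem_conj_core[OF F.subset U(1)] by auto
  moreover have "compactin T F"
    using F(1) FG topspace_eq_carrier by (simp add: finite_imp_compactin)
  ultimately show thesis
    using that F U by (simp add: expansive_pair_def)
qed

end

lemma (in topological_group) openin_Inter_finite_carrier:
  assumes "finite F" "\<And>f. f \<in> F \<Longrightarrow> openin T (A f)"
  shows "openin T (carrier G \<inter> (\<Inter>f\<in>F. A f))"
  using assms by (induction F) (auto simp: topspace_eq_carrier[symmetric] Int_left_commute)

text \<open>
  Replace \<open>K\<close> by a finite set \<open>F\<close>, and let \<open>V\<close> consist of the elements that \<open>F\<close> and \<open>F\<^sup>-\<^sup>1\<close> conjugate into \<open>U\<close>. If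
  \<open>N \<inter> U\<close> is contained in \<open>V\<close>, then \<open>N \<inter> U\<close> is stable under conjugation by \<open>\<langle>F\<rangle>\<close>, so it lies in the core and is
  trivial. Finiteness of \<open>F\<close> makes \<open>V\<close> open, so that \<open>U - V\<close> is compact.
\<close>

lemma (in topological_group) compact_transversal_of_normals:
  assumes pair: "expansive_pair G T K U"
  obtains C where "compactin T C" "\<one> \<notin> C" "C \<subseteq> U"
    "\<And>N. N \<lhd> G \<Longrightarrow> N \<inter> U \<noteq> {\<one>} \<Longrightarrow> N \<inter> C \<noteq> {}"
proof -
  have U: "subgroup U G" and K: "K \<subseteq> carrier G"
    using pair compactin_carrier by (auto simp: expansive_pair_def)
  interpret U: subgroup U G by fact
  have clG: "T closure_of carrier G = carrier G"
    using closure_of_topspace[of T] topspace_eq_carrier by simp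
  have "K \<subseteq> carrier G <#> U"
  proof
    fix k assume "k \<in> K"
    then have "k = k \<otimes> \<one>" "k \<in> carrier G"
      using K by auto
    then show "k \<in> carrier G <#> U"
      unfolding set_mult_def using U.one_closed by blast
  qed
  then obtain F where F: "finite F" "F \<subseteq> carrier G" "expansive_pair G T F U"
    using expansive_pair_perturb[OF pair subgroup_self] clG normal_self by metis
  have cU: "compactin T U" and oU: "openin T U"
    and core: "conj_core G (generate G F) U = {\<one>}"
    using F(3) by (auto simp: expansive_pair_def)
  define E where "E = F \<union> (\<lambda>x. inv x) ` F"
  have E: "finite E" "E \<subseteq> carrier G"
    using F(1,2) by (auto simp: E_def)
  define V where "V = carrier G \<inter> (\<Inter>f\<in>E. {x \<in> carrier G. inv f \<otimes> x \<otimes> f \<in> U})"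
  have "openin T {x \<in> carrier G. inv f \<otimes> x \<otimes> f \<in> U}" if "f \<in> E" for f
    using oU that E(2)
    by (intro openin_preimage_group continuous_map_group_intros continuous_map_id[unfolded id_def]) auto
  then have "openin T V"
    unfolding V_def by (intro openin_Inter_finite_carrier E(1))
  have "compactin T (U \<inter> (topspace T - V))"
    using compact_Int_closedin[OF cU] \<open>openin T V\<close> by (simp add: closedin_diff)
  moreover have "\<one> \<in> V"
    using E(2) by (auto simp: V_def subset_iff)
  moreover have "N \<inter> (U \<inter> (topspace T - V)) \<noteq> {}" if N: "N \<lhd> G" "N \<inter> U \<noteq> {\<one>}" for N
  proof
    assume empty: "N \<inter> (U \<inter> (topspace T - V)) = {}"
    interpret N: normal N G by (rule N)
    have step: "inv f \<otimes> x \<otimes> f \<in> N \<inter> U" if "f \<in> E" "x \<in> N \<inter> U" for f x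
    proof -
      have "x \<in> V"
        using empty that by (auto simp: topspace_eq_carrier)
      then show ?thesis
        using that E(2) N.inv_op_closed1[of f x] by (auto simp: V_def)
    qed
    have "inv d \<otimes> x \<otimes> d \<in> N \<inter> U" if "d \<in> generate G F" "x \<in> N \<inter> U" for d x
      using that
    proof (induction d arbitrary: x)
      case one
      then show ?case
        by auto
    next
      case (incl h)
      then show ?case
        by (intro step) (auto simp: E_def)
    next
      case (inv h)
      then show ?case
        by (intro step) (auto simp: E_def)
    next
      case (eng h1 h2)
      then have "h1 \<in> carrier G" "h2 \<in> carrier G" "x \<in> carrier G"
        using generate_in_carrier[OF F(2)] by auto
      then have "inv (h1 \<otimes> h2) \<otimes> x \<otimes> (h1 \<otimes> h2) = inv h2 \<otimes> (inv h1 \<otimes> x \<otimes> h1) \<otimes> h2"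
        by (simp add: m_assoc inv_mult_group)
      then show ?case
        using eng.IH(2)[OF eng.IH(1)[OF eng.prems]] by simp
    qed
    then have "N \<inter> U \<subseteq> conj_core G (generate G F) U"
      by (auto simp: conj_core_def)
    then show False
      using core N(2) N.one_closed U.one_closed by auto
  qed
  ultimately show thesis
    using that[of "U \<inter> (topspace T - V)"] by blast
qed

section \<open>Groups with a regionally expansive, topologically simple normal subgroup\<close>

lemma (in group) commute_with_generate:
  assumes "F \<subseteq> carrier G" "w \<in> carrier G" "\<And>f. f \<in> F \<Longrightarrow> f \<otimes> w = w \<otimes> f"
    and "g \<in> generate G F"
  shows "g \<otimes> w = w \<otimes> g"
  using assms(4)
proof (induction g)
  case one
  then show ?case
    using assms(2) by simp
next
  case (incl h)
  then show ?case
    by (rule assms(3))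
next
  case (inv h)
  then have "h \<in> carrier G"
    using assms(1) by blast
  have "inv h \<otimes> w = inv h \<otimes> (w \<otimes> h) \<otimes> inv h"
    using \<open>h \<in> carrier G\<close> assms(2) by (simp add: m_assoc)
  also have "\<dots> = w \<otimes> inv h"
    unfolding assms(3)[OF inv, symmetric] using \<open>h \<in> carrier G\<close> assms(2) by (simp add: m_assoc)
  finally show ?case .
next
  case (eng h1 h2)
  then have "h1 \<in> carrier G" "h2 \<in> carrier G"
    using generate_in_carrier[OF assms(1)] by auto
  then have "h1 \<otimes> h2 \<otimes> w = (h1 \<otimes> w) \<otimes> h2"
    using eng.IH(2) assms(2) by (simp add: m_assoc)
  also have "\<dots> = w \<otimes> (h1 \<otimes> h2)"
    using eng.IH(1) assms(2) \<open>h1 \<in> carrier G\<close> \<open>h2 \<in> carrier G\<close> by (simp add: m_assoc)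
  finally show ?case .
qed

lemma (in group) centralizer_of_normal:
  assumes "M \<lhd> G"
  shows "{g \<in> carrier G. \<forall>m\<in>M. g \<otimes> m = m \<otimes> g} \<lhd> G" (is "?C \<lhd> G")
proof (rule normal_invI)
  interpret M: normal M G by fact
  show "subgroup ?C G"
  proof (rule subgroupI)
    show "?C \<subseteq> carrier G"
      by auto
    have "\<one> \<in> ?C"
      by simp
    then show "?C \<noteq> {}"
      by blast
    show "inv a \<in> ?C" if "a \<in> ?C" for a
      using that commute_with_generate[of "{a}" _ "inv a"] generate.inv[of a "{a}" G] by auto
    show "a \<otimes> b \<in> ?C" if ab: "a \<in> ?C" "b \<in> ?C" for a b
    proof -
      have "a \<otimes> b \<in> generate G {a, b}"
        by (intro generate.eng generate.incl) simp_all
      then have "a \<otimes> b \<otimes> m = m \<otimes> (a \<otimes> b)" if "m \<in> M" for m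
        by (rule commute_with_generate[rotated 3]) (use ab that in auto)
      then show ?thesis
        using ab by simp
    qed
  qed
  fix x g assume x: "x \<in> carrier G" and "g \<in> ?C"
  then have g: "g \<in> carrier G" "\<forall>m\<in>M. g \<otimes> m = m \<otimes> g"
    by auto
  have "x \<otimes> g \<otimes> inv x \<otimes> m = m \<otimes> (x \<otimes> g \<otimes> inv x)" if m: "m \<in> M" for m
  proof -
    let ?n = "inv x \<otimes> m \<otimes> x"
    have mG: "m \<in> carrier G"
      using m by simp
    have "x \<otimes> g \<otimes> inv x \<otimes> m = x \<otimes> (g \<otimes> ?n) \<otimes> inv x"
      using x g(1) mG by (simp add: m_assoc)
    also have "g \<otimes> ?n = ?n \<otimes> g"
      using g(2) M.inv_op_closed1[OF x m] by (rule bspec)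
    also have "x \<otimes> (?n \<otimes> g) \<otimes> inv x = m \<otimes> (x \<otimes> g \<otimes> inv x)"
      using x g(1) mG by (simp add: m_assoc)
    finally show ?thesis .
  qed
  then show "x \<otimes> g \<otimes> inv x \<in> ?C"
    using x g(1) by simp
qed

text \<open>
  The trivial centralizer stands in for monolithicity, so that all the hypotheses pass at once from \<open>G\<close> to
  its closed subgroups containing \<open>M\<close>.
\<close>

locale robust_monolith = topological_group G T
  for G :: "('a, 'm) monoid_scheme" (structure) and T +
  fixes M :: "'a set"
  assumes tdlc: "tdlc_group G T"
    and normal_M: "M \<lhd> G"
    and nondiscrete_M: "nondiscrete (subtopology T M)"
    and simple_M: "topologically_simple (G\<lparr>carrier := M\<rparr>) (subtopology T M)"
    and rexp_M: "regionally_expansive (G\<lparr>carrier := M\<rparr>) (subtopology T M)"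
    and centralizer_M: "\<And>g. g \<in> carrier G \<Longrightarrow> (\<And>m. m \<in> M \<Longrightarrow> g \<otimes> m = m \<otimes> g) \<Longrightarrow> g = \<one>"
begin

sublocale M: normal M G
  by (rule normal_M)

lemma topological_group_M: "topological_group (G\<lparr>carrier := M\<rparr>) (subtopology T M)"
  by (rule subgroup_topological_group[OF M.subgroup_axioms])

lemma M_nontrivial: "M \<noteq> {\<one>}"
  using simple_M by (simp add: topologically_simple_def)

text \<open>
  By topological simplicity \<open>N \<inter> M\<close> is \<open>M\<close> or trivial, and in the latter case \<open>N\<close> centralizes \<open>M\<close>.
\<close>

lemma M_subset_closed_normal:
  assumes N: "N \<lhd> G" "closedin T N" "N \<noteq> {\<one>}"
  shows "M \<subseteq> N"
proof -
  have "N \<inter> M \<lhd> G\<lparr>carrier := M\<rparr>"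
    using normal_Int_subgroup[OF M.subgroup_axioms N(1)] .
  moreover have "closedin (subtopology T M) (N \<inter> M)"
    using N(2) by (auto simp: closedin_subtopology)
  ultimately have "N \<inter> M = {\<one>} \<or> N \<inter> M = M"
    using simple_M by (simp add: topologically_simple_def)
  moreover have "N \<inter> M \<noteq> {\<one>}"
  proof
    assume "N \<inter> M = {\<one>}"
    have "g = \<one>" if g: "g \<in> N" for g
    proof (rule centralizer_M)
      show "g \<in> carrier G"
        using subgroup.mem_carrier[OF normal_imp_subgroup[OF N(1)] g] .
      show "g \<otimes> m = m \<otimes> g" if "m \<in> M" for m
        using normals_commute[OF N(1) normal_M \<open>N \<inter> M = {\<one>}\<close> g that] .
    qed
    then show False
      using N(3) subgroup.one_closed[OF normal_imp_subgroup[OF N(1)]] by blast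
  qed
  ultimately show ?thesis
    by blast
qed

definition quasi_centralizer :: "'a set" where
  "quasi_centralizer =
     {g \<in> carrier G. \<exists>A. openin T A \<and> \<one> \<in> A \<and> (\<forall>m\<in>A \<inter> M. g \<otimes> m = m \<otimes> g)}"

lemma quasi_centralizer_normal: "quasi_centralizer \<lhd> G"
proof (rule normal_invI)
  show "subgroup quasi_centralizer G"
  proof (rule subgroupI)
    show "quasi_centralizer \<subseteq> carrier G"
      by (auto simp: quasi_centralizer_def)
    have "\<one> \<in> quasi_centralizer"
      unfolding quasi_centralizer_def using openin_topspace[of T] topspace_eq_carrier by auto
    then show "quasi_centralizer \<noteq> {}"
      by blast
  next
    fix g assume "g \<in> quasi_centralizer"
    then obtain A where g: "g \<in> carrier G" and A: "openin T A" "\<one> \<in> A" "\<forall>m\<in>A \<inter> M. g \<otimes> m = m \<otimes> g"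
      by (auto simp: quasi_centralizer_def)
    have "inv g \<otimes> m = m \<otimes> inv g" if "m \<in> A \<inter> M" for m
      using commute_with_generate[of "{g}" m "inv g"] A(3) that g
      by (auto intro: generate.inv)
    then show "inv g \<in> quasi_centralizer"
      using g A(1,2) by (auto simp: quasi_centralizer_def)
  next
    fix g h assume "g \<in> quasi_centralizer" "h \<in> quasi_centralizer"
    then obtain A B where g: "g \<in> carrier G" and A: "openin T A" "\<one> \<in> A" "\<forall>m\<in>A \<inter> M. g \<otimes> m = m \<otimes> g"
        and h: "h \<in> carrier G" and B: "openin T B" "\<one> \<in> B" "\<forall>m\<in>B \<inter> M. h \<otimes> m = m \<otimes> h"
      by (auto simp: quasi_centralizer_def)
    have "g \<otimes> h \<otimes> m = m \<otimes> (g \<otimes> h)" if "m \<in> A \<inter> B \<inter> M" for m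
      using commute_with_generate[of "{g, h}" m "g \<otimes> h"] A(3) B(3) that g h
      by (auto intro: generate.eng generate.incl)
    then show "g \<otimes> h \<in> quasi_centralizer"
      using g h A(1,2) B(1,2) unfolding quasi_centralizer_def by (blast intro: openin_Int)
  qed
next
  fix x g assume x: "x \<in> carrier G" and "g \<in> quasi_centralizer"
  then obtain A where g: "g \<in> carrier G" and A: "openin T A" "\<one> \<in> A" "\<forall>m\<in>A \<inter> M. g \<otimes> m = m \<otimes> g"
    by (auto simp: quasi_centralizer_def)
  define B where "B = {m \<in> carrier G. inv x \<otimes> m \<otimes> x \<in> A}"
  have B: "openin T B"
    unfolding B_def using A(1) x
    by (intro openin_preimage_group continuous_map_group_intros continuous_map_id[unfolded id_def]) auto
  have "\<one> \<in> B"
    using A(2) x by (simp add: B_def)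
  moreover have "x \<otimes> g \<otimes> inv x \<otimes> m = m \<otimes> (x \<otimes> g \<otimes> inv x)" if m: "m \<in> B \<inter> M" for m
  proof -
    have mG: "m \<in> carrier G"
      using m by auto
    have "x \<otimes> g \<otimes> inv x \<otimes> m = x \<otimes> (g \<otimes> (inv x \<otimes> m \<otimes> x)) \<otimes> inv x"
      using x g mG by (simp add: m_assoc)
    also have "g \<otimes> (inv x \<otimes> m \<otimes> x) = (inv x \<otimes> m \<otimes> x) \<otimes> g"
      using A(3) m M.inv_op_closed1[OF x] by (auto simp: B_def)
    also have "x \<otimes> ((inv x \<otimes> m \<otimes> x) \<otimes> g) \<otimes> inv x = m \<otimes> (x \<otimes> g \<otimes> inv x)"
      using x g mG by (simp add: m_assoc)
    finally show ?thesis .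
  qed
  ultimately show "x \<otimes> g \<otimes> inv x \<in> quasi_centralizer"
    using B x g unfolding quasi_centralizer_def by blast
qed

text \<open>
  The intersection \<open>Z\<close> is the quasi-centre of \<open>M\<close>. If it is non-trivial, it is dense in \<open>M\<close>, so \<open>M\<close> has an
  expansive pair \<open>(F, U)\<close> with \<open>F \<subseteq> Z\<close> finite. The elements of \<open>U\<close> close enough to \<open>\<one>\<close> commute with \<open>F\<close>, so they lie
  in the core, which is trivial.
\<close>

lemma quasi_centralizer_Int_M: "quasi_centralizer \<inter> M = {\<one>}"
proof (rule ccontr)
  assume nontriv: "quasi_centralizer \<inter> M \<noteq> {\<one>}"
  let ?GM = "G\<lparr>carrier := M\<rparr>" and ?TM = "subtopology T M"
  interpret GM: topological_group ?GM ?TM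
    by (rule topological_group_M)
  define Z where "Z = quasi_centralizer \<inter> M"
  have Z: "Z \<lhd> ?GM"
    unfolding Z_def by (rule normal_Int_subgroup[OF M.subgroup_axioms quasi_centralizer_normal])
  interpret Z: normal Z ?GM
    by (rule Z)
  have clZ: "?TM closure_of Z \<lhd> ?GM"
  proof (rule GM.closure_of_normal_in_closure[OF GM.subgroup_self Z.subgroup_axioms])
    show "?TM closure_of carrier ?GM = carrier ?GM"
      using closure_of_topspace[of ?TM] GM.topspace_eq_carrier by simp
  qed (rule Z.inv_op_closed2)
  have ZclZ: "Z \<subseteq> ?TM closure_of Z"
    using GM.subset_closure_of_carrier[OF Z.subset] .
  moreover have "Z \<noteq> {\<one>}" "\<one> \<in> Z"
    using nontriv Z.one_closed by (auto simp: Z_def)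
  ultimately have "?TM closure_of Z \<noteq> {\<one>}"
    by blast
  then have dense: "?TM closure_of Z = M"
    using simple_M clZ closedin_closure_of by (auto simp: topologically_simple_def)
  obtain K U where KU: "expansive_pair ?GM ?TM K U"
    using GM.regionally_expansive_imp_expansive_pair[OF rexp_M] by blast
  have "K \<subseteq> M"
    using KU GM.compactin_carrier by (auto simp: expansive_pair_def)
  have subU: "subgroup U ?GM"
    using KU by (simp add: expansive_pair_def)
  have "K \<subseteq> M <#>\<^bsub>?GM\<^esub> U"
    using \<open>K \<subseteq> M\<close> subgroup.one_closed[OF subU] unfolding set_mult_def by force
  then obtain F where F: "finite F" "F \<subseteq> Z" "expansive_pair ?GM ?TM F U"
    using GM.expansive_pair_perturb[OF KU Z.subgroup_axioms clZ] dense by metis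
  have "\<forall>f\<in>F. \<exists>A. openin T A \<and> \<one> \<in> A \<and> (\<forall>m\<in>A \<inter> M. f \<otimes> m = m \<otimes> f)"
    using F(2) by (auto simp: Z_def quasi_centralizer_def)
  then obtain A where A: "\<And>f. f \<in> F \<Longrightarrow> openin T (A f)" "\<And>f. f \<in> F \<Longrightarrow> \<one> \<in> A f"
      "\<And>f m. f \<in> F \<Longrightarrow> m \<in> A f \<Longrightarrow> m \<in> M \<Longrightarrow> f \<otimes> m = m \<otimes> f"
    by (metis IntI)
  define W where "W = U \<inter> (carrier G \<inter> (\<Inter>f\<in>F. A f))"
  have "openin ?TM W"
  proof -
    have "openin ?TM U" "U \<subseteq> M"
      using F(3) GM.openin_subset_carrier by (auto simp: expansive_pair_def)
    moreover have "openin ?TM (M \<inter> (carrier G \<inter> (\<Inter>f\<in>F. A f)))"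
      using openin_Inter_finite_carrier[OF F(1) A(1)] by (simp add: openin_subtopology_Int2)
    moreover have "W = U \<inter> (M \<inter> (carrier G \<inter> (\<Inter>f\<in>F. A f)))"
      using \<open>U \<subseteq> M\<close> by (auto simp: W_def)
    ultimately show ?thesis
      by (metis openin_Int)
  qed
  moreover have "W = {\<one>}"
  proof
    have "\<one> \<in> U"
      using subgroup.one_closed[OF subU] by simp
    then show "{\<one>} \<subseteq> W"
      using A(2) by (auto simp: W_def)
    show "W \<subseteq> {\<one>}"
    proof
      fix w assume w: "w \<in> W"
      have wM: "w \<in> M" "w \<in> U"
        using w GM.openin_subset_carrier[OF \<open>openin ?TM W\<close>] by (auto simp: W_def)
      have FM: "F \<subseteq> carrier ?GM"
        using F(2) Z.subset by blast
      have "inv\<^bsub>?GM\<^esub> d \<otimes>\<^bsub>?GM\<^esub> w \<otimes>\<^bsub>?GM\<^esub> d \<in> U" if d: "d \<in> generate ?GM F" for d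
      proof -
        have dM: "d \<in> carrier ?GM"
          using d GM.generate_in_carrier[OF FM] by blast
        have "d \<otimes>\<^bsub>?GM\<^esub> w = w \<otimes>\<^bsub>?GM\<^esub> d"
          by (rule GM.commute_with_generate[OF FM _ _ d]) (use w wM A(3) in \<open>auto simp: W_def\<close>)
        then have "inv\<^bsub>?GM\<^esub> d \<otimes>\<^bsub>?GM\<^esub> w \<otimes>\<^bsub>?GM\<^esub> d = w"
          using GM.inv_mult_cancel(1)[OF dM, of w] GM.m_assoc[OF GM.inv_closed[OF dM], of w d] dM wM
          by simp
        then show ?thesis
          using wM by simp
      qed
      then have "w \<in> conj_core ?GM (generate ?GM F) U"
        using wM by (simp add: conj_core_def)
      then show "w \<in> {\<one>}"
        using F(3) by (simp add: expansive_pair_def)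
    qed
  qed
  ultimately have "\<not> nondiscrete ?TM"
    using discrete_if_open_singleton_one[OF topological_group_M] by simp
  then show False
    using nondiscrete_M by simp
qed

lemma quasi_centralizer_trivial:
  assumes "g \<in> carrier G" "openin T A" "\<one> \<in> A" "\<And>m. m \<in> A \<inter> M \<Longrightarrow> g \<otimes> m = m \<otimes> g"
  shows "g = \<one>"
proof (rule centralizer_M[OF assms(1)])
  have "g \<in> quasi_centralizer"
    using assms by (auto simp: quasi_centralizer_def)
  then show "g \<otimes> m = m \<otimes> g" if "m \<in> M" for m
    using normals_commute[OF quasi_centralizer_normal normal_M quasi_centralizer_Int_M] that by blast
qed

text \<open>
  Start from an expansive pair \<open>(K1, U1)\<close> of \<open>M\<close>, choose a compact open subgroup \<open>U\<close> of \<open>G\<close> with \<open>U \<inter> M \<subseteq> U1\<close>, and add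
  \<open>U\<close> to \<open>K1\<close>. The core of \<open>U\<close> in \<open>\<langle>K1 \<union> U\<rangle>\<close> is normalized by \<open>U \<inter> M\<close> and meets \<open>M\<close> trivially, so it centralizes
  \<open>U \<inter> M\<close>, a neighbourhood of \<open>\<one>\<close> in \<open>M\<close>. Hence the core is trivial.
\<close>

lemma expansive_pair_exists:
  obtains K U where "expansive_pair G T K U" "K \<subseteq> M <#> U"
proof -
  let ?GM = "G\<lparr>carrier := M\<rparr>" and ?TM = "subtopology T M"
  interpret GM: topological_group ?GM ?TM
    by (rule topological_group_M)
  obtain K1 U1 where "expansive_pair ?GM ?TM K1 U1"
    using GM.regionally_expansive_imp_expansive_pair[OF rexp_M] by blast
  then have K1: "compactin ?TM K1" and U1: "subgroup U1 ?GM" "openin ?TM U1"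
    and core1: "conj_core ?GM (generate ?GM K1) U1 = {\<one>}"
    by (simp_all add: expansive_pair_def)
  have K1T: "compactin T K1" "K1 \<subseteq> M"
    using K1 by (simp_all add: compactin_subtopology)
  obtain A where A: "openin T A" "U1 = A \<inter> M"
    using U1(2) by (auto simp: openin_subtopology)
  have "\<one> \<in> A"
    using subgroup.one_closed[OF U1(1)] A(2) by simp
  then obtain U where U: "subgroup U G" "compactin T U" "openin T U" "U \<subseteq> A"
    using van_Dantzig[OF tdlc A(1)] by blast
  interpret U: subgroup U G by fact
  define K where "K = K1 \<union> U"
  have KG: "K \<subseteq> carrier G"
    using K1T(2) M.subset U.subset by (auto simp: K_def)
  have core: "c = \<one>" if c: "c \<in> conj_core G (generate G K) U" for c
  proof (rule quasi_centralizer_trivial[OF _ U(3) U.one_closed])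
    show cG: "c \<in> carrier G"
      using c by (simp add: conj_core_def)
    have conj: "inv d \<otimes> c \<otimes> d \<in> U" if "d \<in> generate G K" for d
      using c that by (simp add: conj_core_def)
    fix x assume x: "x \<in> U \<inter> M"
    show "c \<otimes> x = x \<otimes> c"
    proof (rule commutes_if_commutator_one[OF cG])
      show xG: "x \<in> carrier G"
        using x by simp
      define e where "e = c \<otimes> x \<otimes> inv c \<otimes> inv x"
      have eM: "e \<in> M"
        unfolding e_def using x M.inv_op_closed2[OF cG] by auto
      have "inv f \<otimes> e \<otimes> f \<in> U1" if f: "f \<in> generate ?GM K1" for f
      proof -
        have fM: "f \<in> M"
          using GM.generate_in_carrier[of K1 f] K1T(2) f by simp
        have fK: "f \<in> generate G K"
          using f generate_consistent[OF K1T(2) M.subgroup_axioms] mono_generate[of K1 K]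
          by (auto simp: K_def)
        have fG: "f \<in> carrier G"
          using fM by simp
        \<comment> \<open>The conjugate of the commutator by \<open>f\<close> is a product of conjugates of \<open>c\<close> and \<open>c\<^sup>-\<^sup>1\<close>, by \<open>f\<close> and \<open>x\<^sup>-\<^sup>1 f\<close>.\<close>
        have "inv x \<otimes> f \<in> generate G K"
          using x fK by (intro generate.eng generate.inv) (auto simp: K_def)
        then have "inv (inv x \<otimes> f) \<otimes> c \<otimes> (inv x \<otimes> f) \<in> U"
          by (rule conj)
        then have "(inv f \<otimes> c \<otimes> f) \<otimes> inv (inv (inv x \<otimes> f) \<otimes> c \<otimes> (inv x \<otimes> f)) \<in> U"
          using conj[OF fK] by blast
        moreover have "(inv f \<otimes> c \<otimes> f) \<otimes> inv (inv (inv x \<otimes> f) \<otimes> c \<otimes> (inv x \<otimes> f)) = inv f \<otimes> e \<otimes> f"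
          unfolding e_def using xG cG fG by (simp add: inv_mult_group m_assoc)
        ultimately have "inv f \<otimes> e \<otimes> f \<in> U"
          by simp
        moreover have "inv f \<otimes> e \<otimes> f \<in> M"
          using M.inv_op_closed1[OF fG eM] .
        ultimately show ?thesis
          using U(4) A(2) by blast
      qed
      moreover have "inv\<^bsub>?GM\<^esub> f = inv f" if "f \<in> generate ?GM K1" for f
        using that GM.generate_in_carrier[of K1 f] K1T(2) M.subgroup_axioms by simp
      ultimately have "e \<in> conj_core ?GM (generate ?GM K1) U1"
        using eM by (simp add: conj_core_def)
      then show "c \<otimes> x \<otimes> inv c \<otimes> inv x = \<one>"
        using core1 by (simp add: e_def)
    qed
  qed
  have "generate G K \<subseteq> carrier G"
    using KG by (rule generate_incl)
  then have "conj_core G (generate G K) U = {\<one>}"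
    using core one_mem_conj_core[OF _ U(1)] by blast
  moreover have "compactin T K"
    unfolding K_def using K1T(1) U(2) by (rule compactin_Un)
  ultimately have "expansive_pair G T K U"
    using U by (simp add: expansive_pair_def)
  moreover have "K \<subseteq> M <#> U"
  proof
    fix k assume "k \<in> K"
    then consider "k \<in> M" | "k \<in> U"
      using K1T(2) by (auto simp: K_def)
    then show "k \<in> M <#> U"
    proof cases
      case 1
      then have "k = k \<otimes> \<one>"
        by simp
      then show ?thesis
        unfolding set_mult_def using 1 U.one_closed by blast
    next
      case 2
      then show ?thesis
        using mem_set_mult_right M.one_closed by simp
    qed
  qed
  ultimately show thesis
    by (rule that)
qed

end

section \<open>Monoliths\<close>

text \<open>
  The intersection with the carrier in the definition of the monolith adds the whole group to the
  family, so both claims are about intersections of normal, respectively closed, sets.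
\<close>

lemma monolith_normal:
  assumes "topological_group G T"
  shows "monolith G T \<lhd> G" "closedin T (monolith G T)"
proof -
  interpret topological_group G T by fact
  show "monolith G T \<lhd> G"
  proof (rule normal_invI)
    have eq: "monolith G T = \<Inter> (insert (carrier G) {N. N \<lhd> G \<and> closedin T N \<and> N \<noteq> {\<one>\<^bsub>G\<^esub>}})"
      by (auto simp: monolith_def)
    show "subgroup (monolith G T) G"
      unfolding eq by (rule subgroups_Inter) (auto simp: subgroup_self normal_imp_subgroup)
    show "x \<otimes>\<^bsub>G\<^esub> h \<otimes>\<^bsub>G\<^esub> inv\<^bsub>G\<^esub> x \<in> monolith G T"
      if "x \<in> carrier G" "h \<in> monolith G T" for x h
      using that by (auto simp: monolith_def intro: normal.inv_op_closed2)
  qed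
  have "monolith G T = \<Inter> (insert (topspace T) {N. N \<lhd> G \<and> closedin T N \<and> N \<noteq> {\<one>\<^bsub>G\<^esub>}})"
    by (auto simp: monolith_def topspace_eq_carrier)
  also have "closedin T \<dots>"
    by (rule closedin_Inter) auto
  finally show "closedin T (monolith G T)" .
qed

text \<open>
  Conjugation by \<open>h \<in> G\<close> is an automorphism of the topological group \<open>R\<close>, and so it permutes the closed normal
  subgroups of \<open>R\<close>.
\<close>

lemma (in topological_group) monolith_of_normal_is_normal:
  assumes R: "R \<lhd> G" "closedin T R"
  shows "monolith (G\<lparr>carrier := R\<rparr>) (subtopology T R) \<lhd> G"
proof (rule normal_invI)
  let ?R = "G\<lparr>carrier := R\<rparr>" and ?TR = "subtopology T R"
  interpret R: normal R G by (rule R)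
  interpret RR: topological_group ?R ?TR
    by (rule subgroup_topological_group[OF R.subgroup_axioms])
  have "subgroup (monolith ?R ?TR) ?R"
    using monolith_normal(1)[OF RR.topological_group_axioms] by (rule normal_imp_subgroup)
  then show "subgroup (monolith ?R ?TR) G"
    by (rule incl_subgroup[OF R.subgroup_axioms])
  fix h x assume h: "h \<in> carrier G" and x: "x \<in> monolith ?R ?TR"
  have xR: "x \<in> R"
    using x by (simp add: monolith_def)
  have "h \<otimes> x \<otimes> inv h \<in> A" if A: "A \<lhd> ?R" "closedin ?TR A" "A \<noteq> {\<one>}" for A
  proof -
    interpret A: normal A ?R by (rule A)
    have AR: "A \<subseteq> R"
      using A.subset by simp
    have A_G: "subgroup A G"
      by (rule incl_subgroup[OF R.subgroup_axioms A.subgroup_axioms])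
    interpret AG: subgroup A G
      by (rule A_G)
    \<comment> \<open>The conjugate \<open>h\<^sup>-\<^sup>1 A h\<close>; as \<open>x\<close> lies in it, \<open>h x h\<^sup>-\<^sup>1\<close> lies in \<open>A\<close>.\<close>
    define B where "B = {r \<in> R. h \<otimes> r \<otimes> inv h \<in> A}"
    have "subgroup B ?R"
    proof (rule RR.subgroupI)
      show "B \<subseteq> carrier ?R"
        by (auto simp: B_def)
      have "\<one> \<in> B"
        using h by (simp add: B_def)
      then show "B \<noteq> {}"
        by blast
    next
      fix a assume a: "a \<in> B"
      then have aR: "a \<in> R" "h \<otimes> a \<otimes> inv h \<in> A"
        by (simp_all add: B_def)
      have "h \<otimes> inv a \<otimes> inv h = inv (h \<otimes> a \<otimes> inv h)"
        using h aR(1) by (simp add: inv_mult_group m_assoc)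
      then have "inv a \<in> B"
        using aR by (simp add: B_def)
      then show "inv\<^bsub>?R\<^esub> a \<in> B"
        using aR(1) R.subgroup_axioms by simp
    next
      fix a b assume "a \<in> B" "b \<in> B"
      then have ab: "a \<in> R" "b \<in> R" "h \<otimes> a \<otimes> inv h \<in> A" "h \<otimes> b \<otimes> inv h \<in> A"
        by (simp_all add: B_def)
      have "h \<otimes> (a \<otimes> b) \<otimes> inv h = (h \<otimes> a \<otimes> inv h) \<otimes> (h \<otimes> b \<otimes> inv h)"
        using h ab(1,2) by (simp add: m_assoc)
      then show "a \<otimes>\<^bsub>?R\<^esub> b \<in> B"
        using ab by (simp add: B_def)
    qed
    then have "B \<lhd> ?R"
    proof (rule RR.normal_invI)
      fix r b assume r: "r \<in> carrier ?R" and "b \<in> B"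
      then have rb: "r \<in> R" "b \<in> R" "h \<otimes> b \<otimes> inv h \<in> A"
        by (simp_all add: B_def)
      have s: "h \<otimes> r \<otimes> inv h \<in> R"
        using R.inv_op_closed2[OF h rb(1)] .
      have "(h \<otimes> r \<otimes> inv h) \<otimes> (h \<otimes> b \<otimes> inv h) \<otimes> inv (h \<otimes> r \<otimes> inv h) \<in> A"
        using A.inv_op_closed2[of "h \<otimes> r \<otimes> inv h" "h \<otimes> b \<otimes> inv h"] s rb(3) R.subgroup_axioms
        by simp
      moreover have "(h \<otimes> r \<otimes> inv h) \<otimes> (h \<otimes> b \<otimes> inv h) \<otimes> inv (h \<otimes> r \<otimes> inv h)
          = h \<otimes> (r \<otimes> b \<otimes> inv r) \<otimes> inv h"
        using h rb(1,2) by (simp add: m_assoc inv_mult_group)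
      ultimately show "r \<otimes>\<^bsub>?R\<^esub> b \<otimes>\<^bsub>?R\<^esub> inv\<^bsub>?R\<^esub> r \<in> B"
        using rb(1,2) R.subgroup_axioms by (simp add: B_def)
    qed
    moreover have "closedin ?TR B"
    proof -
      have "closedin T A"
        using closedin_trans_full[OF A(2) R(2)] .
      moreover have "continuous_map T T (\<lambda>x. h \<otimes> x \<otimes> inv h)"
        using h by (intro continuous_map_group_intros continuous_map_id[unfolded id_def]) auto
      ultimately have "closedin T {x \<in> topspace T. h \<otimes> x \<otimes> inv h \<in> A}"
        by (simp add: closedin_continuous_map_preimage)
      moreover have "B = {x \<in> topspace T. h \<otimes> x \<otimes> inv h \<in> A} \<inter> R"
        using R.subset by (auto simp: B_def topspace_eq_carrier)
      ultimately show ?thesis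
        by (auto simp: closedin_subtopology)
    qed
    moreover have "B \<noteq> {\<one>}"
    proof -
      obtain a where a: "a \<in> A" "a \<noteq> \<one>"
        using A(3) AG.one_closed by blast
      have aG: "a \<in> carrier G"
        using a(1) by simp
      have "h \<otimes> (inv h \<otimes> a \<otimes> h) \<otimes> inv h = a"
        using h aG by (simp add: m_assoc)
      moreover from this have "inv h \<otimes> a \<otimes> h \<noteq> \<one>"
        using a(2) h by auto
      moreover have "inv h \<otimes> a \<otimes> h \<in> R"
        using R.inv_op_closed1[OF h] a(1) AR by blast
      ultimately have "inv h \<otimes> a \<otimes> h \<in> B" "inv h \<otimes> a \<otimes> h \<noteq> \<one>"
        using a(1) by (simp_all add: B_def)
      then show ?thesis
        by blast
    qed
    ultimately have "x \<in> B"
      using x by (simp add: monolith_def)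
    then show ?thesis
      by (simp add: B_def)
  qed
  moreover have "h \<otimes> x \<otimes> inv h \<in> R"
    using R.inv_op_closed2[OF h xR] .
  ultimately show "h \<otimes> x \<otimes> inv h \<in> monolith ?R ?TR"
    by (simp add: monolith_def)
qed

text \<open>
  If the centralizer of the monolith, a closed normal subgroup, were non-trivial, it would contain the
  monolith. The monolith would be abelian, and then the compact open subgroup of an expansive pair would equal
  its own core, so that \<open>{\<one>}\<close> would be open.
\<close>

lemma robustly_monolithic_imp_robust_monolith:
  assumes G: "robustly_monolithic G T"
  shows "robust_monolith G T (monolith G T)"
proof -
  define M where "M = monolith G T"
  have tdlc: "tdlc_group G T" and M_nontriv: "M \<noteq> {\<one>\<^bsub>G\<^esub>}"
    and nondisc: "nondiscrete (subtopology T M)"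
    and rexp: "regionally_expansive (G\<lparr>carrier := M\<rparr>) (subtopology T M)"
    and simple: "topologically_simple (G\<lparr>carrier := M\<rparr>) (subtopology T M)"
    using G by (simp_all add: robustly_monolithic_def monolithic_def Let_def M_def)
  interpret topological_group G T
    using tdlc by (simp add: tdlc_group_def locally_compact_group_def)
  have M: "M \<lhd> G"
    unfolding M_def by (rule monolith_normal[OF topological_group_axioms])
  interpret M: normal M G by (rule M)
  interpret GM: topological_group "G\<lparr>carrier := M\<rparr>" "subtopology T M"
    by (rule subgroup_topological_group[OF M.subgroup_axioms])
  have nonabelian: False if comm: "\<And>a b. a \<in> M \<Longrightarrow> b \<in> M \<Longrightarrow> a \<otimes>\<^bsub>G\<^esub> b = b \<otimes>\<^bsub>G\<^esub> a"
  proof -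
    obtain K U where KU: "expansive_pair (G\<lparr>carrier := M\<rparr>) (subtopology T M) K U"
      using GM.regionally_expansive_imp_expansive_pair[OF rexp] by blast
    then have U: "subgroup U (G\<lparr>carrier := M\<rparr>)" "openin (subtopology T M) U" and K: "K \<subseteq> M"
      and core: "conj_core (G\<lparr>carrier := M\<rparr>) (generate (G\<lparr>carrier := M\<rparr>) K) U = {\<one>\<^bsub>G\<^esub>}"
      using GM.compactin_carrier by (simp_all add: expansive_pair_def)
    have "inv\<^bsub>G\<lparr>carrier := M\<rparr>\<^esub> d \<otimes>\<^bsub>G\<^esub> u \<otimes>\<^bsub>G\<^esub> d = u" if "u \<in> U" "d \<in> M" for u d
    proof -
      have "u \<in> M"
        using that subgroup.subset[OF U(1)] by auto
      then have "u \<otimes>\<^bsub>G\<^esub> d = d \<otimes>\<^bsub>G\<^esub> u"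
        using comm that by blast
      then show ?thesis
        using \<open>u \<in> M\<close> that M.subgroup_axioms by (simp add: m_assoc)
    qed
    moreover have "generate (G\<lparr>carrier := M\<rparr>) K \<subseteq> M"
      using GM.generate_incl[of K] K by simp
    ultimately have "U \<subseteq> conj_core (G\<lparr>carrier := M\<rparr>) (generate (G\<lparr>carrier := M\<rparr>) K) U"
      using subgroup.subset[OF U(1)] by (auto simp: conj_core_def subset_iff)
    then have "U = {\<one>\<^bsub>G\<^esub>}"
      using core subgroup.one_closed[OF U(1)] by auto
    then show False
      using discrete_if_open_singleton_one[OF GM.topological_group_axioms] U(2) nondisc by simp
  qed
  define C where "C = {g \<in> carrier G. \<forall>m\<in>M. g \<otimes>\<^bsub>G\<^esub> m = m \<otimes>\<^bsub>G\<^esub> g}"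
  have C: "C \<lhd> G"
    unfolding C_def by (rule centralizer_of_normal[OF M])
  have C_carr: "C \<subseteq> carrier G"
    by (auto simp: C_def)
  have "T closure_of C \<subseteq> C"
  proof
    fix g assume g: "g \<in> T closure_of C"
    have "g \<otimes>\<^bsub>G\<^esub> m = m \<otimes>\<^bsub>G\<^esub> g" if "m \<in> M" for m
      by (rule closure_of_commute[OF C_carr M.subset _ g])
        (use that subset_closure_of_carrier[OF M.subset] in \<open>auto simp: C_def\<close>)
    then show "g \<in> C"
      using g closure_of_subset_carrier by (auto simp: C_def)
  qed
  then have C_closed: "closedin T C"
    using C_carr by (metis closure_of_subset_eq topspace_eq_carrier)
  have C_trivial: "C = {\<one>\<^bsub>G\<^esub>}"
  proof (rule ccontr)
    assume "C \<noteq> {\<one>\<^bsub>G\<^esub>}"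
    then have "M \<subseteq> C"
      using C C_closed by (auto simp: M_def monolith_def)
    then show False
      by (intro nonabelian) (auto simp: C_def)
  qed
  have "robust_monolith_axioms G T M"
  proof
    show "g = \<one>\<^bsub>G\<^esub>" if "g \<in> carrier G" "\<And>m. m \<in> M \<Longrightarrow> g \<otimes>\<^bsub>G\<^esub> m = m \<otimes>\<^bsub>G\<^esub> g" for g
      using C_trivial that by (auto simp: C_def)
  qed (fact tdlc M nondisc simple rexp)+
  then show ?thesis
    unfolding M_def by (rule robust_monolith.intro[OF topological_group_axioms])
qed

section \<open>Dense locally compact subgroups\<close>

locale dense_in_robust_monolith =
  robust_monolith G T M + H: topological_group H S
  for G :: "('a, 'm) monoid_scheme" (structure) and T and M
    and H :: "('b, 'n) monoid_scheme" and S +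
  fixes \<psi> :: "'b \<Rightarrow> 'a"
  assumes locally_compact_H: "locally_compact_space S"
    and nondiscrete_H: "nondiscrete S"
    and hom: "\<psi> \<in> hom H G"
    and continuous: "continuous_map S T \<psi>"
    and injective: "inj_on \<psi> (carrier H)"
    and dense: "T closure_of (\<psi> ` carrier H) = carrier G"
begin

sublocale hom: group_hom H G \<psi>
  using hom by unfold_locales

lemma tdlc_H: "tdlc_group H S"
proof -
  have "totally_disconnected_space S"
    using totally_disconnected_if_injective_map[OF continuous] injective tdlc
    by (simp add: H.topspace_eq_carrier tdlc_group_def)
  then show ?thesis
    using locally_compact_H H.topological_group_axioms
    by (simp add: tdlc_group_def locally_compact_group_def)
qed

lemma eq_one_if_image_one: "x \<in> carrier H \<Longrightarrow> \<psi> x = \<one> \<Longrightarrow> x = \<one>\<^bsub>H\<^esub>"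
  using injective by (metis H.one_closed hom.hom_one inj_onD)

lemma openin_vimage:
  assumes "openin T U"
  shows "openin S {h \<in> carrier H. \<psi> h \<in> U}"
  using openin_continuous_map_preimage[OF continuous assms] H.topspace_eq_carrier by simp

lemma closure_of_image_normal:
  assumes "N \<lhd> H"
  shows "T closure_of (\<psi> ` N) \<lhd> G"
proof -
  interpret N: normal N H by fact
  show ?thesis
  proof (rule closure_of_normal_in_closure[OF _ _ _ dense])
    show "subgroup (\<psi> ` carrier H) G" "subgroup (\<psi> ` N) G"
      by (intro hom.subgroup_img_is_subgroup H.subgroup_self N.subgroup_axioms)+
    show "d \<otimes> n \<otimes> inv d \<in> \<psi> ` N" if mem: "d \<in> \<psi> ` carrier H" "n \<in> \<psi> ` N" for d n
    proof -
      obtain h x where hx: "h \<in> carrier H" "x \<in> N" and dn: "d = \<psi> h" "n = \<psi> x"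
        using mem by auto
      have "d \<otimes> n \<otimes> inv d = \<psi> (h \<otimes>\<^bsub>H\<^esub> x \<otimes>\<^bsub>H\<^esub> inv\<^bsub>H\<^esub> h)"
        using hx unfolding dn by simp
      then show ?thesis
        using imageI[OF N.inv_op_closed2[OF hx], of \<psi>] by simp
    qed
  qed
qed

text \<open>
  Density of \<open>\<psi>(H)\<close> makes the closure of \<open>\<psi>(N)\<close> normal in \<open>G\<close>.
\<close>

lemma M_subset_closure_of_image:
  assumes N: "N \<lhd> H" "N \<noteq> {\<one>\<^bsub>H\<^esub>}"
  shows "M \<subseteq> T closure_of (\<psi> ` N)"
proof (rule M_subset_closed_normal[OF closure_of_image_normal[OF N(1)] closedin_closure_of])
  interpret N: normal N H by (rule N)
  obtain n where n: "n \<in> N" "n \<noteq> \<one>\<^bsub>H\<^esub>"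
    using N(2) N.one_closed by blast
  have "\<psi> n \<noteq> \<one>"
    using n eq_one_if_image_one[of n] by auto
  moreover have "\<psi> ` N \<subseteq> carrier G"
    using N.subset hom.hom_closed by auto
  then have "\<psi> n \<in> T closure_of (\<psi> ` N)"
    using subset_closure_of_carrier[of "\<psi> ` N"] n(1) by auto
  ultimately show "T closure_of (\<psi> ` N) \<noteq> {\<one>}"
    by blast
qed

lemma expansive_pair_in_normal:
  assumes N: "N \<lhd> H" "N \<noteq> {\<one>\<^bsub>H\<^esub>}"
  obtains F U where "finite F" "F \<subseteq> N" "expansive_pair G T (\<psi> ` F) U"
proof -
  interpret N: normal N H by (rule N)
  obtain K U where KU: "expansive_pair G T K U" "K \<subseteq> M <#> U"
    by (rule expansive_pair_exists)
  have "subgroup (\<psi> ` N) G"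
    by (rule hom.subgroup_img_is_subgroup[OF N.subgroup_axioms])
  moreover have "K \<subseteq> T closure_of (\<psi> ` N) <#> U"
    using KU(2) mono_set_mult[OF M_subset_closure_of_image[OF N] subset_refl] by blast
  ultimately obtain F' where "finite F'" "F' \<subseteq> \<psi> ` N" "expansive_pair G T F' U"
    using expansive_pair_perturb[OF KU(1) _ closure_of_image_normal[OF N(1)]] by metis
  then show thesis
    using that by (metis finite_subset_image)
qed

lemma carrier_H_nontrivial: "carrier H \<noteq> {\<one>\<^bsub>H\<^esub>}"
proof
  assume "carrier H = {\<one>\<^bsub>H\<^esub>}"
  then have "openin S {\<one>\<^bsub>H\<^esub>}"
    using openin_topspace[of S] H.topspace_eq_carrier by simp
  then show False
    using discrete_if_open_singleton_one[OF H.topological_group_axioms] nondiscrete_H by simp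
qed

text \<open>
  Triviality of the core is an algebraic condition, so it survives pulling back along the injective
  homomorphism \<open>\<psi>\<close>, whatever the topology of \<open>H\<close>.
\<close>

lemma conj_core_pullback:
  assumes "E \<subseteq> carrier H" "conj_core G (generate G (\<psi> ` E)) U = {\<one>}"
    and "x \<in> carrier H" "\<And>d. d \<in> generate H E \<Longrightarrow> \<psi> (inv\<^bsub>H\<^esub> d \<otimes>\<^bsub>H\<^esub> x \<otimes>\<^bsub>H\<^esub> d) \<in> U"
  shows "x = \<one>\<^bsub>H\<^esub>"
proof -
  have "inv d \<otimes> \<psi> x \<otimes> d \<in> U" if "d \<in> generate G (\<psi> ` E)" for d
  proof -
    obtain e where e: "e \<in> generate H E" "d = \<psi> e"
      using \<open>d \<in> generate G (\<psi> ` E)\<close> hom.generate_img[OF assms(1)] by blast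
    have "e \<in> carrier H"
      using H.generate_in_carrier[OF assms(1) e(1)] .
    then show ?thesis
      using assms(3) assms(4)[OF e(1)] e(2) by simp
  qed
  then have "\<psi> x \<in> conj_core G (generate G (\<psi> ` E)) U"
    using assms(3) by (simp add: conj_core_def)
  then show ?thesis
    using assms(2,3) eq_one_if_image_one[of x] by simp
qed

lemma expansive_pair_H:
  obtains E V where "expansive_pair H S E V"
proof -
  obtain E U where E: "finite E" "E \<subseteq> carrier H" and pair: "expansive_pair G T (\<psi> ` E) U"
    using expansive_pair_in_normal[OF H.normal_self carrier_H_nontrivial] by blast
  have U: "subgroup U G" "openin T U" and core: "conj_core G (generate G (\<psi> ` E)) U = {\<one>}"
    using pair by (simp_all add: expansive_pair_def)
  obtain V where V: "subgroup V H" "compactin S V" "openin S V" "V \<subseteq> {h \<in> carrier H. \<psi> h \<in> U}"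
    using van_Dantzig[OF tdlc_H openin_vimage[OF U(2)]] subgroup.one_closed[OF U(1)] by auto
  have "x = \<one>\<^bsub>H\<^esub>" if x: "x \<in> conj_core H (generate H E) V" for x
    by (rule conj_core_pullback[OF E(2) core]) (use x V(4) in \<open>auto simp: conj_core_def\<close>)
  then have "conj_core H (generate H E) V = {\<one>\<^bsub>H\<^esub>}"
    using H.one_mem_conj_core[OF H.generate_incl[OF E(2)] V(1)] by blast
  moreover have "compactin S E"
    using E H.topspace_eq_carrier by (simp add: finite_imp_compactin)
  ultimately show thesis
    using that V by (simp add: expansive_pair_def)
qed

lemma regionally_expansive_H: "regionally_expansive H S"
  using H.expansive_pair_imp_regionally_expansive[OF tdlc_H] expansive_pair_H by blast

text \<open>
  If \<open>N\<close> meets \<open>A\<close> only in \<open>\<one>\<close>, each \<open>f \<in> N\<close> commutes with all \<open>h\<close> close to \<open>\<one>\<close>, since their commutator lies in both \<open>N\<close>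
  and \<open>A\<close>. Taking an expansive pair of \<open>G\<close> with finite first component \<open>\<psi>(F)\<close>, \<open>F \<subseteq> N\<close>, the elements of \<open>H\<close> close to \<open>\<one>\<close>
  are mapped into the core, so \<open>H\<close> would be discrete.
\<close>

lemma normal_meets_nbhd:
  assumes N: "N \<lhd> H" "N \<noteq> {\<one>\<^bsub>H\<^esub>}" and A: "openin S A" "\<one>\<^bsub>H\<^esub> \<in> A"
  shows "N \<inter> A \<noteq> {\<one>\<^bsub>H\<^esub>}"
proof
  assume NA: "N \<inter> A = {\<one>\<^bsub>H\<^esub>}"
  interpret N: normal N H by (rule N)
  obtain F U where F: "finite F" "F \<subseteq> N" and pair: "expansive_pair G T (\<psi> ` F) U"
    using expansive_pair_in_normal[OF N] by blast
  have U: "subgroup U G" "openin T U" and core: "conj_core G (generate G (\<psi> ` F)) U = {\<one>}"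
    using pair by (simp_all add: expansive_pair_def)
  have FH: "F \<subseteq> carrier H"
    using F(2) N.subset by blast
  define B where "B f = {h \<in> carrier H. h \<otimes>\<^bsub>H\<^esub> f \<otimes>\<^bsub>H\<^esub> inv\<^bsub>H\<^esub> h \<otimes>\<^bsub>H\<^esub> inv\<^bsub>H\<^esub> f \<in> A}" for f
  have oB: "openin S (B f)" if "f \<in> F" for f
    unfolding B_def using A(1) that FH
    by (intro H.openin_preimage_group H.continuous_map_group_intros continuous_map_id[unfolded id_def])
      auto
  have comm: "f \<otimes>\<^bsub>H\<^esub> h = h \<otimes>\<^bsub>H\<^esub> f" if "f \<in> F" "h \<in> B f" for f h
  proof (rule H.commutes_if_commutator_one[symmetric])
    show hf: "h \<in> carrier H" "f \<in> carrier H"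
      using that FH by (auto simp: B_def)
    have "f \<in> N"
      using that F(2) by blast
    then have "h \<otimes>\<^bsub>H\<^esub> f \<otimes>\<^bsub>H\<^esub> inv\<^bsub>H\<^esub> h \<otimes>\<^bsub>H\<^esub> inv\<^bsub>H\<^esub> f \<in> N"
      using N.inv_op_closed2[OF hf(1)] by blast
    then show "h \<otimes>\<^bsub>H\<^esub> f \<otimes>\<^bsub>H\<^esub> inv\<^bsub>H\<^esub> h \<otimes>\<^bsub>H\<^esub> inv\<^bsub>H\<^esub> f = \<one>\<^bsub>H\<^esub>"
      using NA that(2) by (auto simp: B_def)
  qed
  define W where "W = {h \<in> carrier H. \<psi> h \<in> U} \<inter> (carrier H \<inter> (\<Inter>f\<in>F. B f))"
  have "openin S W"
    unfolding W_def by (intro openin_Int openin_vimage[OF U(2)] H.openin_Inter_finite_carrier F(1) oB)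
  moreover have "W = {\<one>\<^bsub>H\<^esub>}"
  proof
    show "{\<one>\<^bsub>H\<^esub>} \<subseteq> W"
      using FH A(2) subgroup.one_closed[OF U(1)] by (auto simp: W_def B_def subset_iff)
    show "W \<subseteq> {\<one>\<^bsub>H\<^esub>}"
    proof
      fix w assume w: "w \<in> W"
      have wH: "w \<in> carrier H"
        using w by (simp add: W_def)
      have "w = \<one>\<^bsub>H\<^esub>"
      proof (rule conj_core_pullback[OF FH core wH])
        fix d assume d: "d \<in> generate H F"
        have dH: "d \<in> carrier H"
          using H.generate_in_carrier[OF FH d] .
        have "d \<otimes>\<^bsub>H\<^esub> w = w \<otimes>\<^bsub>H\<^esub> d"
          by (rule H.commute_with_generate[OF FH wH _ d]) (use comm w in \<open>auto simp: W_def\<close>)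
        then have "inv\<^bsub>H\<^esub> d \<otimes>\<^bsub>H\<^esub> w \<otimes>\<^bsub>H\<^esub> d = w"
          using H.inv_mult_cancel(1)[OF dH wH] H.m_assoc[OF H.inv_closed[OF dH] wH dH] by simp
        then show "\<psi> (inv\<^bsub>H\<^esub> d \<otimes>\<^bsub>H\<^esub> w \<otimes>\<^bsub>H\<^esub> d) \<in> U"
          using w by (simp add: W_def)
      qed
      then show "w \<in> {\<one>\<^bsub>H\<^esub>}"
        by simp
    qed
  qed
  ultimately show False
    using discrete_if_open_singleton_one[OF H.topological_group_axioms] nondiscrete_H by simp
qed

lemma nondiscrete_normal:
  assumes N: "N \<lhd> H" "N \<noteq> {\<one>\<^bsub>H\<^esub>}"
  shows "nondiscrete (subtopology S N)"
  unfolding nondiscrete_def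
proof
  assume disc: "subtopology S N = discrete_topology (topspace (subtopology S N))"
  have one: "\<one>\<^bsub>H\<^esub> \<in> N"
    using subgroup.one_closed[OF normal_imp_subgroup[OF N(1)]] .
  then have "\<one>\<^bsub>H\<^esub> \<in> topspace (subtopology S N)"
    using H.topspace_eq_carrier by simp
  then have "openin (subtopology S N) {\<one>\<^bsub>H\<^esub>}"
    by (subst disc) simp
  then obtain A where "openin S A" "{\<one>\<^bsub>H\<^esub>} = A \<inter> N"
    by (auto simp: openin_subtopology)
  then show False
    using normal_meets_nbhd[OF N] by blast
qed

text \<open>
  If the intersection is trivial, then \<open>N1\<close> and \<open>N2\<close> commute, and so do the closures of their images. Both closures
  contain \<open>M\<close>, so \<open>M\<close> would lie in its own centralizer.
\<close>

lemma normal_Int_nontrivial: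
  assumes N1: "N1 \<lhd> H" "N1 \<noteq> {\<one>\<^bsub>H\<^esub>}" and N2: "N2 \<lhd> H" "N2 \<noteq> {\<one>\<^bsub>H\<^esub>}"
  shows "N1 \<inter> N2 \<noteq> {\<one>\<^bsub>H\<^esub>}"
proof
  assume triv: "N1 \<inter> N2 = {\<one>\<^bsub>H\<^esub>}"
  have sub: "N1 \<subseteq> carrier H" "N2 \<subseteq> carrier H"
    using N1(1) N2(1) normal_imp_subgroup subgroup.subset by blast+
  have img: "\<psi> ` N1 \<subseteq> carrier G" "\<psi> ` N2 \<subseteq> carrier G"
    using sub by auto
  have comm: "a \<otimes> b = b \<otimes> a" if ab: "a \<in> \<psi> ` N1" "b \<in> \<psi> ` N2" for a b
  proof -
    obtain x y where xy: "x \<in> N1" "y \<in> N2" "a = \<psi> x" "b = \<psi> y"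
      using ab by blast
    then have "x \<otimes>\<^bsub>H\<^esub> y = y \<otimes>\<^bsub>H\<^esub> x"
      by (intro H.normals_commute[OF N1(1) N2(1) triv])
    moreover have "x \<in> carrier H" "y \<in> carrier H"
      using xy sub by auto
    ultimately show ?thesis
      using xy hom.hom_mult by metis
  qed
  have "m = \<one>" if m: "m \<in> M" for m
  proof (rule centralizer_M)
    show "m \<in> carrier G"
      using m by simp
    show "m \<otimes> n = n \<otimes> m" if "n \<in> M" for n
      using M_subset_closure_of_image[OF N1] M_subset_closure_of_image[OF N2] m that
      by (intro closure_of_commute[OF img comm]) auto
  qed
  then show False
    using M_nontrivial M.one_closed by blast
qed

text \<open>
  Finite intersections of non-trivial closed normal subgroups are again non-trivial, and they
  all meet a compact set that omits \<open>\<one>\<close>, so the finite intersection property yields a common element other than \<open>\<one>\<close>.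
\<close>

lemma monolith_H_nontrivial: "monolith H S \<noteq> {\<one>\<^bsub>H\<^esub>}"
proof -
  obtain E V where pair: "expansive_pair H S E V"
    by (rule expansive_pair_H)
  then have V: "openin S V" "\<one>\<^bsub>H\<^esub> \<in> V"
    using subgroup.one_closed by (auto simp: expansive_pair_def)
  obtain C where C: "compactin S C" "\<one>\<^bsub>H\<^esub> \<notin> C" "C \<subseteq> V"
      "\<And>N. N \<lhd> H \<Longrightarrow> N \<inter> V \<noteq> {\<one>\<^bsub>H\<^esub>} \<Longrightarrow> N \<inter> C \<noteq> {}"
    using H.compact_transversal_of_normals[OF pair] by blast
  let ?\<N> = "{N. N \<lhd> H \<and> closedin S N \<and> N \<noteq> {\<one>\<^bsub>H\<^esub>}}"
  have meet: "C \<inter> \<Inter>\<F> \<noteq> {}" if \<F>: "finite \<F>" "\<F> \<subseteq> ?\<N>" for \<F>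
  proof -
    have "carrier H \<inter> \<Inter>\<F> \<lhd> H \<and> carrier H \<inter> \<Inter>\<F> \<noteq> {\<one>\<^bsub>H\<^esub>}"
      using \<F>
    proof (induction \<F>)
      case empty
      then show ?case
        using H.normal_self carrier_H_nontrivial by simp
    next
      case (insert N \<F>)
      have "carrier H \<inter> \<Inter>(insert N \<F>) = N \<inter> (carrier H \<inter> \<Inter>\<F>)"
        by auto
      then show ?case
        using insert H.normal_subgroup_intersect normal_Int_nontrivial by auto
    qed
    then have "(carrier H \<inter> \<Inter>\<F>) \<inter> C \<noteq> {}"
      using C(4)[of "carrier H \<inter> \<Inter>\<F>"] normal_meets_nbhd[OF _ _ V, of "carrier H \<inter> \<Inter>\<F>"]
      by simp
    then show ?thesis
      by auto
  qed
  have "C \<inter> \<Inter>?\<N> \<noteq> {}"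
  proof (rule C(1)[unfolded compactin_fip, THEN conjunct2, THEN spec, THEN mp], intro conjI allI impI)
    show "\<forall>N\<in>?\<N>. closedin S N"
      by simp
    show "C \<inter> \<Inter>\<F> \<noteq> {}" if "finite \<F> \<and> \<F> \<subseteq> ?\<N>" for \<F>
      using that by (elim conjE) (rule meet)
  qed
  then obtain c where c: "c \<in> C" "c \<in> \<Inter>?\<N>"
    by blast
  then have "c \<in> monolith H S" "c \<noteq> \<one>\<^bsub>H\<^esub>"
    using C(2) H.compactin_carrier[OF C(1)] unfolding monolith_def by auto
  then show ?thesis
    by auto
qed

end

context dense_in_robust_monolith
begin

text \<open>
  The closure of \<open>\<psi>(R)\<close> contains \<open>M\<close>, so it satisfies the hypotheses that \<open>G\<close> satisfies, with the same \<open>M\<close>; and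
  \<open>R\<close> is dense in it and not discrete. This permits a second application of the results on \<open>H\<close>.
\<close>

lemma restrict_to_normal:
  assumes R: "R \<lhd> H" "closedin S R" "R \<noteq> {\<one>\<^bsub>H\<^esub>}"
  shows "dense_in_robust_monolith
    (G\<lparr>carrier := T closure_of (\<psi> ` R)\<rparr>) (subtopology T (T closure_of (\<psi> ` R))) M
    (H\<lparr>carrier := R\<rparr>) (subtopology S R) \<psi>"
proof -
  define L where "L = T closure_of (\<psi> ` R)"
  have L: "L \<lhd> G" "closedin T L"
    using closure_of_image_normal[OF R(1)] by (simp_all add: L_def)
  have M_sub_L: "M \<subseteq> L"
    unfolding L_def by (rule M_subset_closure_of_image[OF R(1,3)])
  interpret L: normal L G by (rule L)
  interpret R: normal R H by (rule R)
  have "\<psi> ` R \<subseteq> carrier G"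
    using R.subset hom.hom_closed by auto
  then have RL: "\<psi> ` R \<subseteq> L"
    unfolding L_def by (rule subset_closure_of_carrier)
  have TM: "subtopology (subtopology T L) M = subtopology T M"
    using M_sub_L by (simp add: subtopology_subtopology Int_absorb1)
  have "topological_group (G\<lparr>carrier := L\<rparr>) (subtopology T L)"
    by (rule subgroup_topological_group[OF L.subgroup_axioms])
  moreover have "robust_monolith_axioms (G\<lparr>carrier := L\<rparr>) (subtopology T L) M"
  proof (rule robust_monolith_axioms.intro)
    show "tdlc_group (G\<lparr>carrier := L\<rparr>) (subtopology T L)"
      by (rule tdlc_group_closed_subgroup[OF tdlc L.subgroup_axioms L(2)])
    show "M \<lhd> G\<lparr>carrier := L\<rparr>"
      by (rule normal_restrict_supergroup[OF L.subgroup_axioms normal_M M_sub_L])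
    show "g = \<one>\<^bsub>G\<lparr>carrier := L\<rparr>\<^esub>"
      if g: "g \<in> carrier (G\<lparr>carrier := L\<rparr>)"
        "\<And>m. m \<in> M \<Longrightarrow> g \<otimes>\<^bsub>G\<lparr>carrier := L\<rparr>\<^esub> m = m \<otimes>\<^bsub>G\<lparr>carrier := L\<rparr>\<^esub> g" for g
    proof -
      have "g = \<one>"
        by (rule centralizer_M) (use g in simp_all)
      then show ?thesis
        by simp
    qed
  qed (use nondiscrete_M simple_M rexp_M TM in simp_all)
  moreover have "topological_group (H\<lparr>carrier := R\<rparr>) (subtopology S R)"
    by (rule H.subgroup_topological_group[OF R.subgroup_axioms])
  moreover have "dense_in_robust_monolith_axioms (G\<lparr>carrier := L\<rparr>) (subtopology T L)
      (H\<lparr>carrier := R\<rparr>) (subtopology S R) \<psi>"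
  proof
    show "locally_compact_space (subtopology S R)"
      by (rule locally_compact_space_closed_subset[OF locally_compact_H R(2)])
    show "nondiscrete (subtopology S R)"
      by (rule nondiscrete_normal[OF R(1,3)])
    show "\<psi> \<in> hom (H\<lparr>carrier := R\<rparr>) (G\<lparr>carrier := L\<rparr>)"
      using RL by (auto simp: hom_def)
    have "continuous_map (subtopology S R) T \<psi>"
      by (rule continuous_map_from_subtopology[OF continuous])
    then show "continuous_map (subtopology S R) (subtopology T L) \<psi>"
      by (rule continuous_map_into_subtopology) (use RL in auto)
    show "inj_on \<psi> (carrier (H\<lparr>carrier := R\<rparr>))"
      using inj_on_subset[OF injective R.subset] by simp
    show "subtopology T L closure_of (\<psi> ` carrier (H\<lparr>carrier := R\<rparr>)) = carrier (G\<lparr>carrier := L\<rparr>)"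
      using RL by (simp add: closure_of_subtopology Int_absorb1 L_def)
  qed
  ultimately show ?thesis
    unfolding L_def[symmetric]
    by (intro dense_in_robust_monolith.intro robust_monolith.intro)
qed

text \<open>
  The monolith of \<open>R\<close> is a non-trivial closed normal subgroup of \<open>H\<close>, hence contains \<open>R\<close>. So every non-trivial closed
  normal subgroup of \<open>R\<close> contains \<open>R\<close>, which is topological simplicity.
\<close>

theorem robustly_monolithic_H: "robustly_monolithic H S"
proof -
  define R where "R = monolith H S"
  have R: "R \<lhd> H" "closedin S R" "R \<noteq> {\<one>\<^bsub>H\<^esub>}"
    using monolith_normal[OF H.topological_group_axioms] monolith_H_nontrivial
    by (simp_all add: R_def)
  interpret R: normal R H by (rule R)
  interpret D: dense_in_robust_monolith
    "G\<lparr>carrier := T closure_of (\<psi> ` R)\<rparr>" "subtopology T (T closure_of (\<psi> ` R))" M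
    "H\<lparr>carrier := R\<rparr>" "subtopology S R" \<psi>
    by (rule restrict_to_normal[OF R])
  let ?R' = "monolith (H\<lparr>carrier := R\<rparr>) (subtopology S R)"
  have "?R' \<lhd> H"
    by (rule H.monolith_of_normal_is_normal[OF R(1,2)])
  moreover have "closedin S ?R'"
    using closedin_trans_full[OF monolith_normal(2)[OF D.H.topological_group_axioms] R(2)] .
  moreover have "?R' \<noteq> {\<one>\<^bsub>H\<^esub>}"
    using D.monolith_H_nontrivial by simp
  ultimately have RR': "R \<subseteq> ?R'"
    by (auto simp: R_def monolith_def)
  have "topologically_simple (H\<lparr>carrier := R\<rparr>) (subtopology S R)"
    unfolding topologically_simple_def
  proof (intro conjI allI impI D.H.topological_group_axioms)
    show "carrier (H\<lparr>carrier := R\<rparr>) \<noteq> {\<one>\<^bsub>H\<lparr>carrier := R\<rparr>\<^esub>}"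
      using R(3) by simp
    fix N assume N: "N \<lhd> H\<lparr>carrier := R\<rparr> \<and> closedin (subtopology S R) N"
    show "N = {\<one>\<^bsub>H\<lparr>carrier := R\<rparr>\<^esub>} \<or> N = carrier (H\<lparr>carrier := R\<rparr>)"
    proof (cases "N = {\<one>\<^bsub>H\<^esub>}")
      case False
      then have "?R' \<subseteq> N"
        using N by (auto simp: monolith_def)
      moreover have "N \<subseteq> R"
        using N subgroup.subset[OF normal_imp_subgroup] by fastforce
      ultimately have "N = R"
        using RR' by (meson order_trans subset_antisym)
      then show ?thesis
        by simp
    qed simp
  qed
  then show ?thesis
    unfolding robustly_monolithic_def monolithic_def
    using tdlc_H R(3) nondiscrete_normal[OF R(1,3)] D.regionally_expansive_H
    by (simp add: tdlc_group_def Let_def flip: R_def)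
qed

end

theorem theorem1p1p2:
  fixes G :: "'a monoid" and T :: "'a topology"
    and H :: "'b monoid" and S :: "'b topology"
    and \<psi> :: "'b \<Rightarrow> 'a"
  assumes "robustly_monolithic G T"
    and "locally_compact_group H S"
    and "nondiscrete S"
    and "dense_embedding H S G T \<psi>"
  shows "robustly_monolithic H S"
proof -
  interpret robust_monolith G T "monolith G T"
    using assms(1) by (rule robustly_monolithic_imp_robust_monolith)
  interpret H: topological_group H S
    using assms(2) by (simp add: locally_compact_group_def)
  have "dense_in_robust_monolith_axioms G T H S \<psi>"
    by unfold_locales
      (use assms in \<open>simp_all add: dense_embedding_def locally_compact_group_def\<close>)
  then interpret dense_in_robust_monolith G T "monolith G T" H S \<psi>
    by (intro dense_in_robust_monolith.intro robust_monolith_axioms H.topological_group_axioms)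
  show ?thesis
    by (rule robustly_monolithic_H)
qed

end
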